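(* Let $\mathbb G$ be a Carnot group and let $E\subseteq \mathbb G$ be a precisely constant-normal set. Then there exists an open contractible cone $C\subseteq\mathbb G$ such that $E$ has the $C$-cone property, i.e. $E\cdot C\subseteq E$.
   Context: A Carnot group $\mathbb G$ is a simply connected Lie group whose Lie algebra is stratified, $V_1\oplus\cdots\oplus V_s$; $V_1$ is the first layer, and $\delta_t$ ($t>0$) is the group automorphism whose differential is multiplication by $t$ on $V_1$. Elements of the Lie algebra are regarded as left-invariant vector fields. A measurable set $E\subseteq\mathbb G$ is precisely $X$-monotone if $E\exp(tX)\subseteq E$ for all $t>0$. A measurable set $E$ is a precisely constant-normal set if there is a closed half-space $W$ of $V_1$ (i.e. $W=\{Y\in V_1:\langle Y,X\rangle\ge 0\}$ for some scalar product on $V_1$ and some $X\in V_1\setminus\{0\}$) such that $E$ is precisely $X$-monotone for every $X\in W$. A cone is a nonempty $C\subseteq\mathbb G$ with $\delta_t(C)=C$ for all $t>0$. *)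

theory Defs
  imports "HOL-Analysis.Analysis" "HOL-Algebra.Coset"
begin

text \<open>Class \<open>C\<^sup>k\<close>, meant for open \<open>S\<close> in a finite-dimensional space. Asking every
  directional derivative to be of class \<open>C\<^sup>k\<close> is then the same as asking it of the derivative.\<close>

primrec Ck_on :: "nat \<Rightarrow> ('a::real_normed_vector \<Rightarrow> 'b::real_normed_vector) \<Rightarrow> 'a set \<Rightarrow> bool" where
  "Ck_on 0 f S \<longleftrightarrow> continuous_on S f"
| "Ck_on (Suc k) f S \<longleftrightarrow>
     (\<forall>x\<in>S. f differentiable (at x)) \<and> (\<forall>v. Ck_on k (\<lambda>x. frechet_derivative f (at x) v) S)"

definition smooth_on :: "('a::real_normed_vector \<Rightarrow> 'b::real_normed_vector) \<Rightarrow> 'a set \<Rightarrow> bool" where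
  "smooth_on f S \<longleftrightarrow> (\<forall>k. Ck_on k f S)"

text \<open>A chart is a pair \<open>(U, \<kappa>)\<close>. Only the values of \<open>\<kappa>\<close> on \<open>U\<close> matter, and its inverse is
  \<open>inv_into U \<kappa>\<close>. The manifold is a whole type; the dimension is that of the Euclidean space
  \<open>'e\<close>.\<close>

type_synonym ('g, 'e) chart = "'g set \<times> ('g \<Rightarrow> 'e)"

definition is_chart :: "('g::topological_space, 'e::euclidean_space) chart \<Rightarrow> bool" where
  "is_chart = (\<lambda>(U, \<kappa>). open U \<and> open (\<kappa> ` U) \<and> homeomorphism U (\<kappa> ` U) \<kappa> (inv_into U \<kappa>))"

definition smooth_atlas :: "('g::topological_space, 'e::euclidean_space) chart set \<Rightarrow> bool" where
  "smooth_atlas A \<longleftrightarrow>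
     (\<forall>c\<in>A. is_chart c) \<and> (\<Union>(U, \<kappa>)\<in>A. U) = UNIV \<and>
     (\<forall>(U, \<kappa>)\<in>A. \<forall>(U', \<kappa>')\<in>A. smooth_on (\<lambda>x. \<kappa>' (inv_into U \<kappa> x)) (\<kappa> ` (U \<inter> U')))"

definition prod_atlas ::
  "('g, 'e) chart set \<Rightarrow> ('h, 'f) chart set \<Rightarrow> ('g \<times> 'h, 'e \<times> 'f) chart set" where
  "prod_atlas A B = {(U \<times> U', map_prod \<kappa> \<kappa>') |U \<kappa> U' \<kappa>'. (U, \<kappa>) \<in> A \<and> (U', \<kappa>') \<in> B}"

definition smooth_map ::
  "('g::topological_space, 'e::euclidean_space) chart set \<Rightarrow>
   ('h::topological_space, 'f::euclidean_space) chart set \<Rightarrow> ('g \<Rightarrow> 'h) \<Rightarrow> bool" where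
  "smooth_map A B f \<longleftrightarrow>
     continuous_on UNIV f \<and>
     (\<forall>(U, \<kappa>)\<in>A. \<forall>(U', \<kappa>')\<in>B.
        smooth_on (\<lambda>x. \<kappa>' (f (inv_into U \<kappa> x))) (\<kappa> ` (U \<inter> f -` U')))"

text \<open>Lebesgue measurability on a manifold; on a Lie group this is measurability with respect to
  the completed Haar measure.\<close>

definition measurable_in :: "('g, 'e::euclidean_space) chart set \<Rightarrow> 'g set \<Rightarrow> bool" where
  "measurable_in A E \<longleftrightarrow> (\<forall>(U, \<kappa>)\<in>A. \<kappa> ` (E \<inter> U) \<in> sets lebesgue)"

locale lie_group = group G
  for G :: "('g::{t2_space, second_countable_topology}, 'm) monoid_scheme" (structure) +
  fixes A :: "('g, 'e::euclidean_space) chart set"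
  assumes carrier_UNIV: "carrier G = UNIV"
    and atlas: "smooth_atlas A"
    and smooth_mult: "smooth_map (prod_atlas A A) A (\<lambda>(x, y). x \<otimes> y)"
    and smooth_inv: "smooth_map A A (\<lambda>x. inv x)"

text \<open>A chart \<open>(U\<^sub>0, \<kappa>\<^sub>0)\<close> around the identity is fixed in order to identify the tangent space at
  the identity, and hence the Lie algebra, with the type \<open>'e\<close>: the vector \<open>v\<close> stands for the
  left-invariant vector field whose value at the identity is \<open>v\<close> in the coordinates \<open>\<kappa>\<^sub>0\<close>.\<close>

locale lie_group_with_chart = lie_group G A
  for G :: "('g::{t2_space, second_countable_topology}, 'm) monoid_scheme" (structure)
    and A :: "('g, 'e::euclidean_space) chart set" +
  fixes U\<^sub>0 :: "'g set" and \<kappa>\<^sub>0 :: "'g \<Rightarrow> 'e"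
  assumes chart_at_one: "(U\<^sub>0, \<kappa>\<^sub>0) \<in> A" "\<one> \<in> U\<^sub>0"
begin

text \<open>The value at \<open>g\<close> of the left-invariant vector field \<open>v\<close>, that is, the image of \<open>v\<close> under the
  differential at the identity of the left translation by \<open>g\<close>, in the coordinates of a chart \<open>\<psi>\<close>
  around \<open>g\<close>.\<close>

definition left_inv_field :: "('g \<Rightarrow> 'e) \<Rightarrow> 'e \<Rightarrow> 'g \<Rightarrow> 'e" where
  "left_inv_field \<psi> v g = frechet_derivative (\<lambda>y. \<psi> (g \<otimes> inv_into U\<^sub>0 \<kappa>\<^sub>0 y)) (at (\<kappa>\<^sub>0 \<one>)) v"

text \<open>The value at the identity of the commutator of the vector fields \<open>v\<close> and \<open>w\<close>: in coordinates
  \<open>[X, Y] = DY X - DX Y\<close>.\<close>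

definition lie_bracket :: "'e \<Rightarrow> 'e \<Rightarrow> 'e" where
  "lie_bracket v w =
     (let X = (\<lambda>x. left_inv_field \<kappa>\<^sub>0 v (inv_into U\<^sub>0 \<kappa>\<^sub>0 x));
          Y = (\<lambda>x. left_inv_field \<kappa>\<^sub>0 w (inv_into U\<^sub>0 \<kappa>\<^sub>0 x));
          e = \<kappa>\<^sub>0 \<one>
      in frechet_derivative Y (at e) (X e) - frechet_derivative X (at e) (Y e))"

definition integral_curve_from_one :: "'e \<Rightarrow> (real \<Rightarrow> 'g) \<Rightarrow> bool" where
  "integral_curve_from_one v \<gamma> \<longleftrightarrow>
     \<gamma> 0 = \<one> \<and> continuous_on UNIV \<gamma> \<and>
     (\<forall>t. \<forall>(U, \<psi>)\<in>A. \<gamma> t \<in> U \<longrightarrow>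
        ((\<lambda>s. \<psi> (\<gamma> s)) has_vector_derivative left_inv_field \<psi> v (\<gamma> t)) (at t))"

definition lie_exp :: "'e \<Rightarrow> 'g" where
  "lie_exp v = (THE \<gamma>. integral_curve_from_one v \<gamma>) 1"

definition lie_automorphism :: "('g \<Rightarrow> 'g) \<Rightarrow> bool" where
  "lie_automorphism \<phi> \<longleftrightarrow> \<phi> \<in> iso G G \<and> smooth_map A A \<phi> \<and> smooth_map A A (inv_into UNIV \<phi>)"

definition differential_at_one :: "('g \<Rightarrow> 'g) \<Rightarrow> 'e \<Rightarrow> 'e" where
  "differential_at_one \<phi> =
     frechet_derivative (\<lambda>x. \<kappa>\<^sub>0 (\<phi> (inv_into U\<^sub>0 \<kappa>\<^sub>0 x))) (at (\<kappa>\<^sub>0 \<one>))"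

end

definition direct_sum_decomposition :: "(nat \<Rightarrow> 'e::real_vector set) \<Rightarrow> nat \<Rightarrow> bool" where
  "direct_sum_decomposition V s \<longleftrightarrow>
     (\<forall>j\<in>{1..s}. subspace (V j)) \<and>
     (\<forall>x. \<exists>!v. (\<forall>j\<in>{1..s}. v j \<in> V j) \<and> (\<forall>j. j \<notin> {1..s} \<longrightarrow> v j = 0) \<and> x = (\<Sum>j=1..s. v j))"

definition stratification ::
  "('e::real_vector \<Rightarrow> 'e \<Rightarrow> 'e) \<Rightarrow> (nat \<Rightarrow> 'e set) \<Rightarrow> nat \<Rightarrow> bool" where
  "stratification br V s \<longleftrightarrow>
     1 \<le> s \<and> direct_sum_decomposition V s \<and>
     (\<forall>j\<in>{1..s}. span {br x y |x y. x \<in> V 1 \<and> y \<in> V j} = (if j < s then V (Suc j) else {0}))"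

text \<open>For \<open>t > 0\<close> the properties required of \<open>\<delta> t\<close> determine it uniquely, since \<open>V 1\<close> generates the
  Lie algebra and the group is connected; such an automorphism exists, since the group is simply
  connected. For \<open>t \<le> 0\<close> the value of \<open>\<delta> t\<close> is irrelevant.\<close>

locale carnot_group = lie_group_with_chart G A U\<^sub>0 \<kappa>\<^sub>0
  for G :: "('g::{t2_space, second_countable_topology}, 'm) monoid_scheme" (structure)
    and A :: "('g, 'e::euclidean_space) chart set"
    and U\<^sub>0 :: "'g set" and \<kappa>\<^sub>0 :: "'g \<Rightarrow> 'e" +
  fixes V :: "nat \<Rightarrow> 'e set" and s :: nat and \<delta> :: "real \<Rightarrow> 'g \<Rightarrow> 'g"
  assumes simply_connected_group: "simply_connected (UNIV :: 'g set)"
    and stratified: "stratification lie_bracket V s"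
    and dilation_automorphism: "\<And>t. t > 0 \<Longrightarrow> lie_automorphism (\<delta> t)"
    and dilation_differential:
      "\<And>t X. t > 0 \<Longrightarrow> X \<in> V 1 \<Longrightarrow> differential_at_one (\<delta> t) X = t *\<^sub>R X"

definition scalar_product_on :: "'e::real_vector set \<Rightarrow> ('e \<Rightarrow> 'e \<Rightarrow> real) \<Rightarrow> bool" where
  "scalar_product_on S ip \<longleftrightarrow>
     (\<forall>x\<in>S. \<forall>y\<in>S. ip x y = ip y x) \<and>
     (\<forall>x\<in>S. \<forall>y\<in>S. \<forall>z\<in>S. ip (x + y) z = ip x z + ip y z) \<and>
     (\<forall>c. \<forall>x\<in>S. \<forall>y\<in>S. ip (c *\<^sub>R x) y = c * ip x y) \<and>
     (\<forall>x\<in>S. x \<noteq> 0 \<longrightarrow> ip x x > 0)"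

definition closed_half_space :: "'e::real_vector set \<Rightarrow> 'e set \<Rightarrow> bool" where
  "closed_half_space S W \<longleftrightarrow>
     (\<exists>ip X. scalar_product_on S ip \<and> X \<in> S - {0} \<and> W = {Y \<in> S. ip Y X \<ge> 0})"

context carnot_group
begin

definition precisely_monotone :: "'e \<Rightarrow> 'g set \<Rightarrow> bool" where
  "precisely_monotone X E \<longleftrightarrow>
     measurable_in A E \<and> (\<forall>t>0. E #> lie_exp (t *\<^sub>R X) \<subseteq> E)"

definition precisely_constant_normal :: "'g set \<Rightarrow> bool" where
  "precisely_constant_normal E \<longleftrightarrow>
     measurable_in A E \<and> (\<exists>W. closed_half_space (V 1) W \<and> (\<forall>X\<in>W. precisely_monotone X E))"

definition cone :: "'g set \<Rightarrow> bool" where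
  "cone C \<longleftrightarrow> C \<noteq> {} \<and> (\<forall>t>0. \<delta> t ` C = C)"

end

end

theory Submission
  imports Defs
begin

text \<open>Let \<open>S\<close> be the semigroup generated by the \<open>exp(tX)\<close> with \<open>X \<in> W\<close> and \<open>t > 0\<close>. Then
  \<open>E S \<subseteq> E\<close>, and the cone is the interior \<open>C\<close> of \<open>S\<close>. It is invariant under dilations because
  \<open>\<delta>\<^sub>t(exp X) = exp(tX)\<close> for \<open>X \<in> V\<^sub>1\<close>, and \<open>(t, x) \<mapsto> \<delta>\<^sub>1\<^sub>-\<^sub>t(x) \<delta>\<^sub>t(p)\<close> contracts it to any of its points \<open>p\<close>.

  That \<open>C\<close> is nonempty is a linear algebra argument. The span of all \<open>Ad(q\<^sup>-\<^sup>1)X\<close> with \<open>q \<in> S\<close> and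
  \<open>X \<in> W\<close> is invariant under \<open>Ad(exp(-tX))\<close>; differentiating at \<open>t = 0\<close> shows that it is closed
  under brackets with \<open>W\<close>, hence it is the whole Lie algebra. The logarithmic derivative of
  \<open>(t\<^sub>1, \<dots>, t\<^sub>k) \<mapsto> exp(t\<^sub>1X\<^sub>1) \<dots> exp(t\<^sub>kX\<^sub>k)\<close> has its columns in this orbit; if its rank is maximal among
  all words, then the rank is full, and the inverse function theorem applies.\<close>

section \<open>Calculus in Euclidean spaces\<close>

text \<open>The group is given by an atlas, so derivatives of group-valued maps are taken as left
  logarithmic derivatives: the increment \<open>inv (f x) \<otimes> f y\<close> is near the
  identity, hence one chart suffices, derivatives at all points take values in the Lie algebra, and
  products and inverses obey short rules with \<open>Ad\<close>. The exponential is differentiated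
  along one-parameter curves only; words with fixed generators and varying times need no more. Only
  positive times lie in the semigroup, so the orbit under \<open>Ad\<close> is differentiated from
  the right; the limit stays in the span because subspaces of finite dimension are closed. The
  contraction needs joint continuity of the dilations up to \<open>t = 0\<close>, while each
  \<open>\<delta> t\<close> is given separately, with no regularity in \<open>t\<close>. This
  continuity comes from the same words: near the identity every element is a quotient of two of
  them, and a dilation multiplies their times by \<open>t\<close>.\<close>

lemma Ck_on_cong:
  assumes "open S" "\<And>x. x \<in> S \<Longrightarrow> f x = g x" "Ck_on k f S"
  shows "Ck_on k g S"
  using assms(2,3)
proof (induction k arbitrary: f g)
  case 0
  then show ?case using continuous_on_cong by (metis Ck_on.simps(1))
next
  case (Suc k)
  have eq: "frechet_derivative f (at x) = frechet_derivative g (at x)" if "x \<in> S" for x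
  proof -
    from that Suc.prems have "f differentiable (at x)" by simp
    then show ?thesis
      using frechet_derivative_transform_within_open[OF _ assms(1) that] Suc.prems(1) by blast
  qed
  have "g differentiable (at x)" if "x \<in> S" for x
  proof -
    from that Suc.prems have "f differentiable (at x)" by simp
    then show ?thesis unfolding differentiable_def
      using has_derivative_transform_within_open[OF _ assms(1) that] Suc.prems(1) by metis
  qed
  moreover have "Ck_on k (\<lambda>x. frechet_derivative g (at x) v) S" for v
    using Suc.IH[of "\<lambda>x. frechet_derivative f (at x) v" "\<lambda>x. frechet_derivative g (at x) v"] eq
      Suc.prems(2) by auto
  ultimately show ?case by simp
qed

lemma frechet_derivative_expand:
  fixes f :: "'a::euclidean_space \<Rightarrow> 'b::real_normed_vector"
  assumes "f differentiable (at x)"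
  shows "frechet_derivative f (at x) v = (\<Sum>b\<in>Basis. (v \<bullet> b) *\<^sub>R frechet_derivative f (at x) b)"
proof -
  interpret linear "frechet_derivative f (at x)"
    using assms by (rule linear_frechet_derivative)
  have "frechet_derivative f (at x) v = frechet_derivative f (at x) (\<Sum>b\<in>Basis. (v \<bullet> b) *\<^sub>R b)"
    by (simp add: euclidean_representation)
  then show ?thesis by (simp add: sum scaleR)
qed

text \<open>\<open>Ck_on\<close> gives continuity of the derivative in a fixed direction; expanding
  the moving direction in the basis reduces the claim to finitely many fixed ones.\<close>

lemma continuous_on_frechet_derivative:
  fixes f :: "'a::euclidean_space \<Rightarrow> 'b::real_normed_vector" and p v :: "'c::topological_space \<Rightarrow> 'a"
  assumes "Ck_on (Suc 0) f S" "continuous_on T p" "p ` T \<subseteq> S" "continuous_on T v"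
  shows "continuous_on T (\<lambda>t. frechet_derivative f (at (p t)) (v t))"
proof -
  have "continuous_on T (\<lambda>t. frechet_derivative f (at (p t)) b)" for b
    using assms by (auto intro!: continuous_on_compose2[of S _ T p])
  then have "continuous_on T (\<lambda>t. \<Sum>b\<in>Basis. (v t \<bullet> b) *\<^sub>R frechet_derivative f (at (p t)) b)"
    using assms(4) by (intro continuous_intros) auto
  then show ?thesis
    by (rule continuous_on_eq) (use assms frechet_derivative_expand[of f] in auto)
qed

section \<open>Symmetry of the second derivative\<close>

lemma second_difference_mean_value:
  fixes f :: "'a::real_normed_vector \<Rightarrow> 'b::euclidean_space" and z :: 'b
  assumes "\<And>a b. 0 \<le> a \<Longrightarrow> a \<le> h \<Longrightarrow> 0 \<le> b \<Longrightarrow> b \<le> h \<Longrightarrow> p + a *\<^sub>R u + b *\<^sub>R v \<in> S"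
    and "Ck_on (Suc (Suc 0)) f S" "0 < h"
  shows "\<exists>a b. 0 < a \<and> a < h \<and> 0 < b \<and> b < h \<and>
    (f (p + h *\<^sub>R u + h *\<^sub>R v) - f (p + h *\<^sub>R u) - f (p + h *\<^sub>R v) + f p) \<bullet> z =
    h * h * (frechet_derivative (\<lambda>x. frechet_derivative f (at x) u) (at (p + a *\<^sub>R u + b *\<^sub>R v)) v \<bullet> z)"
proof -
  let ?g = "\<lambda>x. frechet_derivative f (at x) u"
  have df: "(f has_derivative frechet_derivative f (at x)) (at x)" if "x \<in> S" for x
    using that assms(2) frechet_derivative_works by auto
  have dg: "(?g has_derivative frechet_derivative ?g (at x)) (at x)" if "x \<in> S" for x
    by (rule frechet_derivative_works[THEN iffD1]) (use that assms(2) in auto)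
  have lin: "linear (frechet_derivative f (at x))" "linear (frechet_derivative ?g (at x))" if "x \<in> S" for x
    using df dg that by (auto dest: has_derivative_linear)
  \<comment> \<open>The second difference is an increment of \<open>\<phi>\<close>, so the mean
    value theorem is applied first along \<open>u\<close> and then, to the derivative so obtained,
    along \<open>v\<close>. Pairing with \<open>z\<close> makes the functions real-valued.\<close>
  define \<phi> where "\<phi> s = (f (p + s *\<^sub>R u + h *\<^sub>R v) - f (p + s *\<^sub>R u)) \<bullet> z" for s
  have "\<exists>a. 0 < a \<and> a < h \<and> \<phi> h - \<phi> 0 = (h - 0) * ((?g (p + a *\<^sub>R u + h *\<^sub>R v) - ?g (p + a *\<^sub>R u)) \<bullet> z)"
  proof (rule MVT2[OF assms(3)])
    fix s assume s: "0 \<le> s" "s \<le> h"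
    have S: "p + s *\<^sub>R u + h *\<^sub>R v \<in> S" "p + s *\<^sub>R u \<in> S"
      using assms(1)[OF s, of h] assms(1)[OF s, of 0] assms(3) by auto
    have "((\<lambda>s. f (p + s *\<^sub>R u + h *\<^sub>R v)) has_derivative (\<lambda>d. frechet_derivative f (at (p + s *\<^sub>R u + h *\<^sub>R v)) (d *\<^sub>R u))) (at s)"
      by (rule has_derivative_compose[of "\<lambda>s. p + s *\<^sub>R u + h *\<^sub>R v" "\<lambda>d. d *\<^sub>R u", OF _ df[OF S(1)]]) (auto intro!: derivative_eq_intros)
    moreover have "((\<lambda>s. f (p + s *\<^sub>R u)) has_derivative (\<lambda>d. frechet_derivative f (at (p + s *\<^sub>R u)) (d *\<^sub>R u))) (at s)"
      by (rule has_derivative_compose[of "\<lambda>s. p + s *\<^sub>R u" "\<lambda>d. d *\<^sub>R u", OF _ df[OF S(2)]]) (auto intro!: derivative_eq_intros)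
    ultimately have "(\<phi> has_derivative (\<lambda>d. (frechet_derivative f (at (p + s *\<^sub>R u + h *\<^sub>R v)) (d *\<^sub>R u) - frechet_derivative f (at (p + s *\<^sub>R u)) (d *\<^sub>R u)) \<bullet> z)) (at s)"
      unfolding \<phi>_def by (auto intro!: derivative_eq_intros)
    then show "(\<phi> has_real_derivative (?g (p + s *\<^sub>R u + h *\<^sub>R v) - ?g (p + s *\<^sub>R u)) \<bullet> z) (at s)"
      unfolding has_field_derivative_def
      by (rule has_derivative_eq_rhs) (auto simp: linear_scale[OF lin(1)[OF S(1)]] linear_scale[OF lin(1)[OF S(2)]] inner_diff_left right_diff_distrib fun_eq_iff mult.commute)
  qed
  then obtain a where a: "0 < a" "a < h" "\<phi> h - \<phi> 0 = h * ((?g (p + a *\<^sub>R u + h *\<^sub>R v) - ?g (p + a *\<^sub>R u)) \<bullet> z)"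
    by auto
  define \<psi> where "\<psi> t = ?g (p + a *\<^sub>R u + t *\<^sub>R v) \<bullet> z" for t
  have "\<exists>b. 0 < b \<and> b < h \<and> \<psi> h - \<psi> 0 = (h - 0) * (frechet_derivative ?g (at (p + a *\<^sub>R u + b *\<^sub>R v)) v \<bullet> z)"
  proof (rule MVT2[OF assms(3)])
    fix t assume t: "0 \<le> t" "t \<le> h"
    have S: "p + a *\<^sub>R u + t *\<^sub>R v \<in> S"
      using assms(1)[OF _ _ t, of a] a by auto
    have "((\<lambda>t. ?g (p + a *\<^sub>R u + t *\<^sub>R v)) has_derivative (\<lambda>d. frechet_derivative ?g (at (p + a *\<^sub>R u + t *\<^sub>R v)) (d *\<^sub>R v))) (at t)"
      by (rule has_derivative_compose[of "\<lambda>t. p + a *\<^sub>R u + t *\<^sub>R v" "\<lambda>d. d *\<^sub>R v", OF _ dg[OF S]]) (auto intro!: derivative_eq_intros)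
    then have "(\<psi> has_derivative (\<lambda>d. frechet_derivative ?g (at (p + a *\<^sub>R u + t *\<^sub>R v)) (d *\<^sub>R v) \<bullet> z)) (at t)"
      unfolding \<psi>_def by (auto intro!: derivative_eq_intros)
    then show "(\<psi> has_real_derivative frechet_derivative ?g (at (p + a *\<^sub>R u + t *\<^sub>R v)) v \<bullet> z) (at t)"
      unfolding has_field_derivative_def
      by (rule has_derivative_eq_rhs) (auto simp: linear_scale[OF lin(2)[OF S]])
  qed
  then obtain b where b: "0 < b" "b < h" "\<psi> h - \<psi> 0 = h * (frechet_derivative ?g (at (p + a *\<^sub>R u + b *\<^sub>R v)) v \<bullet> z)"
    by auto
  have "(f (p + h *\<^sub>R u + h *\<^sub>R v) - f (p + h *\<^sub>R u) - f (p + h *\<^sub>R v) + f p) \<bullet> z = \<phi> h - \<phi> 0"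
    by (simp add: \<phi>_def inner_diff_left inner_add_left)
  also have "\<dots> = h * (\<psi> h - \<psi> 0)" using a(3) by (simp add: \<psi>_def inner_diff_left)
  finally show ?thesis using a b by (intro exI[of _ a] exI[of _ b]) simp
qed

lemma second_difference_limit:
  fixes f :: "'a::real_normed_vector \<Rightarrow> 'b::euclidean_space" and z :: 'b
  assumes "open S" "p \<in> S" "Ck_on (Suc (Suc 0)) f S"
  shows "((\<lambda>h. (f (p + h *\<^sub>R u + h *\<^sub>R v) - f (p + h *\<^sub>R u) - f (p + h *\<^sub>R v) + f p) \<bullet> z / (h * h)) \<longlongrightarrow>
    frechet_derivative (\<lambda>x. frechet_derivative f (at x) u) (at p) v \<bullet> z) (at_right 0)"
proof (rule tendstoI)
  fix \<epsilon> :: real assume "\<epsilon> > 0"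
  define G where "G = (\<lambda>x. frechet_derivative (\<lambda>x. frechet_derivative f (at x) u) (at x) v \<bullet> z)"
  have "continuous_on S G"
    unfolding G_def using assms(3) by (auto intro!: continuous_intros)
  then have "isCont G p" using assms(1,2) continuous_on_eq_continuous_at by blast
  then have "eventually (\<lambda>x. x \<in> S \<and> dist (G x) (G p) < \<epsilon>) (nhds p)"
    using assms(1,2) \<open>\<epsilon> > 0\<close> eventually_nhds_in_open[of S p]
    by (auto simp: eventually_conj_iff isCont_def tendsto_iff eventually_nhds_conv_at)
  then obtain d where d: "d > 0" "\<And>x. dist x p < d \<Longrightarrow> x \<in> S \<and> dist (G x) (G p) < \<epsilon>"
    unfolding eventually_nhds_metric by auto
  \<comment> \<open>For \<open>h < c\<close> the parallelogram with sides
    \<open>h *\<^sub>R u\<close> and \<open>h *\<^sub>R v\<close> lies in the ball of radius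
    \<open>d\<close>; the summand 1 keeps the denominator positive when \<open>u\<close> and
    \<open>v\<close> vanish.\<close>
  define c where "c = d / (norm u + norm v + 1)"
  have n: "norm u + norm v + 1 > 0" by (simp add: add_nonneg_pos)
  then have c: "c > 0" using d by (simp add: c_def)
  have near: "dist (p + a *\<^sub>R u + b *\<^sub>R v) p < d" if "0 \<le> a" "a \<le> h" "0 \<le> b" "b \<le> h" "h < c" for a b h
  proof -
    have "dist (p + a *\<^sub>R u + b *\<^sub>R v) p = norm (a *\<^sub>R u + b *\<^sub>R v)" by (simp add: dist_norm)
    also have "\<dots> \<le> a * norm u + b * norm v"
      using that norm_triangle_ineq[of "a *\<^sub>R u" "b *\<^sub>R v"] by simp
    also have "\<dots> \<le> h * norm u + h * norm v"
      using that by (intro add_mono mult_right_mono) auto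
    also have "\<dots> \<le> h * (norm u + norm v + 1)" using that by (simp add: algebra_simps)
    also have "\<dots> < c * (norm u + norm v + 1)" using that n by (intro mult_strict_right_mono) auto
    also have "\<dots> = d" using n by (simp add: c_def)
    finally show ?thesis .
  qed
  have "\<forall>\<^sub>F h in at_right 0. 0 < h \<and> h < c"
    using c by (auto simp: eventually_at_right_field)
  then show "\<forall>\<^sub>F h in at_right 0. dist ((f (p + h *\<^sub>R u + h *\<^sub>R v) - f (p + h *\<^sub>R u) - f (p + h *\<^sub>R v) + f p) \<bullet> z / (h * h))
      (frechet_derivative (\<lambda>x. frechet_derivative f (at x) u) (at p) v \<bullet> z) < \<epsilon>"
  proof eventually_elim
    case (elim h)
    obtain a b where ab: "0 < a" "a < h" "0 < b" "b < h"
      "(f (p + h *\<^sub>R u + h *\<^sub>R v) - f (p + h *\<^sub>R u) - f (p + h *\<^sub>R v) + f p) \<bullet> z =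
        h * h * G (p + a *\<^sub>R u + b *\<^sub>R v)"
      using second_difference_mean_value[of h p u v S f z] near d assms(3) elim unfolding G_def by blast
    have "dist (G (p + a *\<^sub>R u + b *\<^sub>R v)) (G p) < \<epsilon>"
      using d(2) near[of a h b] ab elim by auto
    then show ?case using elim ab(5) by (simp add: G_def)
  qed
qed

text \<open>The second difference is symmetric in \<open>u\<close> and \<open>v\<close>, so the two
  mixed derivatives are limits of the same expression.\<close>

lemma second_derivative_symmetric:
  fixes f :: "'a::real_normed_vector \<Rightarrow> 'b::euclidean_space"
  assumes "open S" "p \<in> S" "Ck_on (Suc (Suc 0)) f S"
  shows "frechet_derivative (\<lambda>x. frechet_derivative f (at x) u) (at p) v =
    frechet_derivative (\<lambda>x. frechet_derivative f (at x) v) (at p) u"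
proof (rule euclidean_eqI)
  fix z :: 'b
  have "((\<lambda>h. (f (p + h *\<^sub>R v + h *\<^sub>R u) - f (p + h *\<^sub>R v) - f (p + h *\<^sub>R u) + f p) \<bullet> z / (h * h)) \<longlongrightarrow>
    frechet_derivative (\<lambda>x. frechet_derivative f (at x) u) (at p) v \<bullet> z) (at_right 0)"
    using second_difference_limit[OF assms, of u v z] by (simp add: algebra_simps)
  then show "frechet_derivative (\<lambda>x. frechet_derivative f (at x) u) (at p) v \<bullet> z =
    frechet_derivative (\<lambda>x. frechet_derivative f (at x) v) (at p) u \<bullet> z"
    using second_difference_limit[OF assms, of v u z] tendsto_unique trivial_limit_at_right_real
    by blast
qed

section \<open>Local existence for ordinary differential equations\<close>

lemma locally_lipschitz:
  fixes f :: "'a::euclidean_space \<Rightarrow> 'b::euclidean_space"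
  assumes "open S" "x\<^sub>0 \<in> S" "Ck_on (Suc 0) f S"
  obtains r L where "r > 0" "L > 0" "cball x\<^sub>0 r \<subseteq> S"
    "\<And>x y. x \<in> cball x\<^sub>0 r \<Longrightarrow> y \<in> cball x\<^sub>0 r \<Longrightarrow> norm (f x - f y) \<le> L * norm (x - y)"
proof -
  obtain r where r: "r > 0" "cball x\<^sub>0 r \<subseteq> S"
    using assms open_contains_cball by blast
  have df: "(f has_derivative frechet_derivative f (at x)) (at x)" if "x \<in> S" for x
    using that assms(3) frechet_derivative_works by auto
  \<comment> \<open>\<open>g\<close> dominates the operator norm of the derivative and is bounded on
    the compact ball; convexity of the ball turns the bound into a Lipschitz constant.\<close>
  define g where "g x = (\<Sum>b\<in>Basis. norm (frechet_derivative f (at x) b))" for x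
  have "continuous_on (cball x\<^sub>0 r) g"
    unfolding g_def using assms(3) r(2) by (auto intro!: continuous_intros intro: continuous_on_subset)
  then have "bounded (g ` cball x\<^sub>0 r)"
    using compact_continuous_image compact_imp_bounded compact_cball by blast
  then obtain L where L: "L > 0" "\<And>x. x \<in> cball x\<^sub>0 r \<Longrightarrow> \<bar>g x\<bar> \<le> L"
    unfolding bounded_pos by auto
  have on: "onorm (frechet_derivative f (at x)) \<le> L" if "x \<in> cball x\<^sub>0 r" for x
  proof (rule onorm_bound)
    show "0 \<le> L" using L by simp
    fix v
    have "norm (frechet_derivative f (at x) v) = norm (\<Sum>b\<in>Basis. (v \<bullet> b) *\<^sub>R frechet_derivative f (at x) b)"
    proof (rule arg_cong[OF frechet_derivative_expand])
      show "f differentiable (at x)" using that r(2) assms(3) by auto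
    qed
    also have "\<dots> \<le> (\<Sum>b\<in>Basis. norm v * norm (frechet_derivative f (at x) b))"
      by (rule sum_norm_le) (auto intro!: mult_right_mono Basis_le_norm)
    also have "\<dots> = norm v * g x" by (simp add: g_def sum_distrib_left)
    also have "\<dots> \<le> L * norm v" using L(2)[OF that] mult_left_mono[of "g x" L "norm v"] by (simp add: mult.commute)
    finally show "norm (frechet_derivative f (at x) v) \<le> L * norm v" .
  qed
  have df': "(f has_derivative frechet_derivative f (at x)) (at x within cball x\<^sub>0 r)"
    if "x \<in> cball x\<^sub>0 r" for x
    using df r(2) that by (blast intro: has_derivative_at_withinI)
  have "norm (f x - f y) \<le> L * norm (x - y)" if "x \<in> cball x\<^sub>0 r" "y \<in> cball x\<^sub>0 r" for x y
    by (rule differentiable_bound[OF convex_cball df' on that])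
  with r L that show ?thesis by blast
qed

text \<open>The solution is a fixed point of an integral operator on the bounded continuous
  functions on the whole line. Composing \<open>f\<close> with the nearest-point projection onto the
  ball makes it Lipschitz and bounded everywhere; the fixed point stays in the ball, where the
  projection does nothing.\<close>

lemma picard_lindelof:
  fixes f :: "'a::euclidean_space \<Rightarrow> 'a"
  assumes "r > 0" "L > 0"
    and lip: "\<And>x y. x \<in> cball x\<^sub>0 r \<Longrightarrow> y \<in> cball x\<^sub>0 r \<Longrightarrow> norm (f x - f y) \<le> L * norm (x - y)"
  obtains h x where "h > 0" "x 0 = x\<^sub>0"
    "\<And>t. \<bar>t\<bar> < h \<Longrightarrow> x t \<in> cball x\<^sub>0 r \<and> (x has_vector_derivative f (x t)) (at t)"
proof -
  define \<pi> where "\<pi> = closest_point (cball x\<^sub>0 r)"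
  have ne: "cball x\<^sub>0 r \<noteq> {}" using assms by simp
  have \<pi>_in: "\<pi> y \<in> cball x\<^sub>0 r" for y
    unfolding \<pi>_def using ne by (intro closest_point_in_set) auto
  have \<pi>_lip: "norm (\<pi> y - \<pi> z) \<le> norm (y - z)" for y z
    using closest_point_lipschitz[of "cball x\<^sub>0 r" y z] ne by (simp add: \<pi>_def dist_norm)
  define F where "F y = f (\<pi> y)" for y
  have F_lip: "norm (F y - F z) \<le> L * norm (y - z)" for y z
    unfolding F_def using assms(2)
    by (intro order_trans[OF lip[OF \<pi>_in \<pi>_in] mult_left_mono[OF \<pi>_lip]]) auto
  have F_cont: "continuous_on UNIV F"
  proof (rule continuous_on_iff[THEN iffD2], intro ballI allI impI)
    fix y :: 'a and e :: real assume "e > 0"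
    have "dist (F z) (F y) < e" if "dist z y < e / L" for z
    proof -
      have "dist (F z) (F y) \<le> L * dist z y" using F_lip by (simp add: dist_norm)
      also have "\<dots> < e" using that assms(2) by (simp add: pos_less_divide_eq mult.commute)
      finally show ?thesis .
    qed
    with \<open>e > 0\<close> assms(2) show "\<exists>d>0. \<forall>z\<in>UNIV. dist z y < d \<longrightarrow> dist (F z) (F y) < e"
      by (intro exI[of _ "e / L"]) auto
  qed
  define B where "B = norm (f x\<^sub>0) + L * r"
  have B: "norm (F y) \<le> B" for y
  proof -
    have "norm (F y) \<le> norm (f x\<^sub>0) + norm (f (\<pi> y) - f x\<^sub>0)"
      unfolding F_def using norm_triangle_sub by blast
    also have "norm (f (\<pi> y) - f x\<^sub>0) \<le> L * norm (\<pi> y - x\<^sub>0)"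
      using \<pi>_in assms(1) by (intro lip) auto
    also have "\<dots> \<le> L * r" using \<pi>_in[of y] assms(2) by (auto simp: dist_norm norm_minus_commute intro!: mult_left_mono)
    finally show ?thesis by (simp add: B_def)
  qed
  have "B > 0" unfolding B_def using assms by (simp add: add_nonneg_pos)
  \<comment> \<open>The operator \<open>P\<close> below subtracts two integrals, each over an
    interval of length at most \<open>2 * h\<close>, whence the factor 4. The first bound yields the
    contraction factor 1/2, the second keeps the values within distance \<open>r\<close> of
    \<open>x\<^sub>0\<close>.\<close>
  define h where "h = min (1 / (8 * L)) (r / (4 * B))"
  have h: "h > 0" "4 * h * L \<le> 1/2" "4 * h * B \<le> r"
  proof -
    show "h > 0" using assms \<open>B > 0\<close> by (simp add: h_def)
    have "h * (8 * L) \<le> 1" using assms(2) pos_le_divide_eq[of "8 * L" h 1] by (simp add: h_def)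
    then show "4 * h * L \<le> 1/2" by simp
    have "h * (4 * B) \<le> r" using \<open>B > 0\<close> pos_le_divide_eq[of "4 * B" h r] by (simp add: h_def)
    then show "4 * h * B \<le> r" by simp
  qed
  define c where "c t = max (-h) (min h t)" for t
  have c: "c t \<in> {-h..h}" for t using h by (auto simp: c_def)
  have c_cont: "continuous_on UNIV c" unfolding c_def by (intro continuous_intros)
  define J where "J u t = integral {-h..t} (\<lambda>s. F (apply_bcontfun u s))" for u t
  have Fu: "continuous_on T (\<lambda>s. F (apply_bcontfun u s))" for u :: "real \<Rightarrow>\<^sub>C 'a" and T
    by (rule continuous_on_compose2[OF F_cont]) auto
  have int: "(\<lambda>s. F (apply_bcontfun u s)) integrable_on {a..b}" for u :: "real \<Rightarrow>\<^sub>C 'a" and a b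
    by (rule integrable_continuous_real[OF Fu])
  have J_bound: "norm (J u t) \<le> 2 * h * B" if "t \<in> {-h..h}" for u t
  proof -
    have "norm (J u t) \<le> B * (t - (- h))"
      unfolding J_def using that B by (intro integral_bound Fu) auto
    also have "\<dots> \<le> B * (2 * h)" using that \<open>B > 0\<close> by (intro mult_left_mono) auto
    finally show ?thesis by (simp add: algebra_simps)
  qed
  have J_diff: "norm (J u t - J w t) \<le> 2 * h * L * dist u w" if "t \<in> {-h..h}" for u w t
  proof -
    have "J u t - J w t = integral {-h..t} (\<lambda>s. F (apply_bcontfun u s) - F (apply_bcontfun w s))"
      unfolding J_def by (rule integral_diff[symmetric]) (rule int)+
    also have "norm \<dots> \<le> (L * dist u w) * (t - (- h))"
    proof (intro integral_bound)
      show "continuous_on {- h..t} (\<lambda>s. F (apply_bcontfun u s) - F (apply_bcontfun w s))"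
        by (intro continuous_intros Fu)
      show "norm (F (apply_bcontfun u s) - F (apply_bcontfun w s)) \<le> L * dist u w" for s
        using assms(2) dist_bounded[of u s w]
        by (intro order_trans[OF F_lip mult_left_mono]) (auto simp: dist_norm)
    qed (use that in auto)
    also have "\<dots> \<le> (L * dist u w) * (2 * h)" using that assms(2) by (intro mult_left_mono) auto
    finally show ?thesis by (simp add: algebra_simps)
  qed
  \<comment> \<open>The integral in \<open>J\<close> starts at \<open>-h\<close>, so negative times
    need no separate case; subtracting \<open>J u 0\<close> restores the initial value at time 0,
    and the clamped time \<open>c t\<close> makes the result bounded on the whole line.\<close>
  define P where "P u t = x\<^sub>0 + (J u (c t) - J u 0)" for u t
  have P_near: "norm (P u t - x\<^sub>0) \<le> r" for u t
  proof -
    have "norm (P u t - x\<^sub>0) \<le> norm (J u (c t)) + norm (J u 0)"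
      by (simp add: P_def norm_triangle_ineq4)
    also have "\<dots> \<le> 2 * h * B + 2 * h * B" using h by (intro add_mono J_bound c) auto
    also have "\<dots> \<le> r" using h(3) by (simp add: algebra_simps)
    finally show ?thesis .
  qed
  have P_bcontfun: "P u \<in> bcontfun" for u
  proof (rule bcontfun_normI)
    have "continuous_on {-h..h} (J u)"
      unfolding J_def by (rule indefinite_integral_continuous_1[OF int])
    then have "continuous_on UNIV (\<lambda>t. J u (c t))"
      by (rule continuous_on_compose2[OF _ c_cont]) (use c in auto)
    then show "continuous_on UNIV (P u)" unfolding P_def by (intro continuous_intros)
    show "norm (P u t) \<le> norm x\<^sub>0 + r" for t
      using P_near[of u t] norm_triangle_sub[of "P u t" x\<^sub>0] by simp
  qed
  define Q where "Q u = Bcontfun (P u)" for u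
  have Q: "apply_bcontfun (Q u) t = P u t" for u t
    unfolding Q_def using P_bcontfun by (simp add: Bcontfun_inverse)
  have "dist (Q u) (Q w) \<le> 1/2 * dist u w" for u w
  proof (rule dist_bound)
    fix t
    have "dist (P u t) (P w t) \<le> norm (J u (c t) - J w (c t)) + norm (J u 0 - J w 0)"
      unfolding P_def dist_norm
      using norm_triangle_ineq4[of "J u (c t) - J w (c t)" "J u 0 - J w 0"] by (simp add: algebra_simps)
    also have "\<dots> \<le> 2 * h * L * dist u w + 2 * h * L * dist u w"
      using J_diff[OF c] h by (intro add_mono J_diff c) auto
    also have "\<dots> = (4 * h * L) * dist u w" by simp
    also have "\<dots> \<le> 1/2 * dist u w" using h by (intro mult_right_mono) auto
    finally show "dist (apply_bcontfun (Q u) t) (apply_bcontfun (Q w) t) \<le> 1/2 * dist u w" by (simp add: Q)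
  qed
  then have "\<exists>!u. Q u = u" by (intro banach_fix_type[of "1/2"]) auto
  then obtain u where "Q u = u" by blast
  then have u: "apply_bcontfun u t = P u t" for t using Q by metis
  let ?x = "apply_bcontfun u"
  have "?x 0 = x\<^sub>0" using h by (simp add: u P_def c_def)
  moreover have "?x t \<in> cball x\<^sub>0 r \<and> (?x has_vector_derivative f (?x t)) (at t)" if "\<bar>t\<bar> < h" for t
  proof -
    have cb: "?x t \<in> cball x\<^sub>0 r" using P_near[of u t] by (simp add: u dist_norm norm_minus_commute)
    then have "F (?x t) = f (?x t)" by (simp add: F_def \<pi>_def closest_point_self)
    moreover have "(J u has_vector_derivative F (?x t)) (at t within {-h..h})"
      unfolding J_def using that by (intro integral_has_vector_derivative Fu) auto
    then have "(J u has_vector_derivative F (?x t)) (at t)"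
      using that by (simp add: at_within_Icc_at)
    then have "((\<lambda>t. x\<^sub>0 + (J u t - J u 0)) has_vector_derivative F (?x t)) (at t)"
      by (auto intro!: derivative_eq_intros)
    then have "(?x has_vector_derivative F (?x t)) (at t)"
    proof (rule has_vector_derivative_transform_within_open)
      show "open {-h<..<h}" "t \<in> {-h<..<h}" using that by auto
      show "x\<^sub>0 + (J u s - J u 0) = ?x s" if "s \<in> {-h<..<h}" for s
        using that by (simp add: u P_def c_def)
    qed
    ultimately show ?thesis using cb by simp
  qed
  ultimately show ?thesis using that h(1) by blast
qed

section \<open>Lie groups in charts and left logarithmic derivatives\<close>

context lie_group
begin

lemma in_carrier [simp]: "x \<in> carrier G"
  by (simp add: carrier_UNIV)

lemma inv_mult_cancel [simp]: "inv x \<otimes> (x \<otimes> y) = y" "x \<otimes> (inv x \<otimes> y) = y"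
  by (simp_all flip: m_assoc)

lemma chartD:
  assumes "(U, \<psi>) \<in> A"
  shows "open U" "open (\<psi> ` U)" "continuous_on U \<psi>" "continuous_on (\<psi> ` U) (inv_into U \<psi>)"
    and "\<And>x. x \<in> U \<Longrightarrow> inv_into U \<psi> (\<psi> x) = x"
proof -
  have "is_chart (U, \<psi>)" using atlas assms unfolding smooth_atlas_def by blast
  then have *: "open U" "open (\<psi> ` U)" "homeomorphism U (\<psi> ` U) \<psi> (inv_into U \<psi>)"
    unfolding is_chart_def by auto
  then show "open U" "open (\<psi> ` U)" "continuous_on U \<psi>" "continuous_on (\<psi> ` U) (inv_into U \<psi>)"
    "\<And>x. x \<in> U \<Longrightarrow> inv_into U \<psi> (\<psi> x) = x"
    unfolding homeomorphism_def by auto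
qed

lemma chart_inv_into:
  assumes "(U, \<psi>) \<in> A" "y \<in> \<psi> ` U"
  shows "inv_into U \<psi> y \<in> U" "\<psi> (inv_into U \<psi> y) = y"
  using assms by (auto simp: inv_into_into f_inv_into_f)

lemma inv_chart_tendsto:
  assumes "(U, \<psi>) \<in> A" "(f \<longlongrightarrow> \<psi> a) F" "a \<in> U"
  shows "((\<lambda>x. inv_into U \<psi> (f x)) \<longlongrightarrow> a) F"
proof -
  have "isCont (inv_into U \<psi>) (\<psi> a)"
    using chartD[OF assms(1)] assms(3) continuous_on_eq_continuous_at by blast
  from isCont_tendsto_compose[OF this assms(2)] show ?thesis
    using chartD(5)[OF assms(1,3)] by simp
qed

lemma chart_at:
  obtains U \<psi> where "(U, \<psi>) \<in> A" "x \<in> U"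
  using atlas unfolding smooth_atlas_def by blast

lemma tendsto_mult_group [tendsto_intros]:
  assumes "(f \<longlongrightarrow> a) F" "(g \<longlongrightarrow> b) F"
  shows "((\<lambda>x. f x \<otimes> g x) \<longlongrightarrow> a \<otimes> b) F"
proof -
  have "isCont (\<lambda>(x, y). x \<otimes> y) (a, b)"
    using smooth_mult unfolding smooth_map_def by (simp add: continuous_on_eq_continuous_at)
  from isCont_tendsto_compose[OF this tendsto_Pair[OF assms]] show ?thesis by simp
qed

lemma tendsto_inv_group [tendsto_intros]:
  assumes "(f \<longlongrightarrow> a) F"
  shows "((\<lambda>x. inv (f x)) \<longlongrightarrow> inv a) F"
proof -
  have "isCont (\<lambda>x. inv x) a"
    using smooth_inv unfolding smooth_map_def by (simp add: continuous_on_eq_continuous_at)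
  from isCont_tendsto_compose[OF this assms] show ?thesis .
qed

lemma continuous_on_mult_group [continuous_intros]:
  "continuous_on S f \<Longrightarrow> continuous_on S g \<Longrightarrow> continuous_on S (\<lambda>x. f x \<otimes> g x)"
  unfolding continuous_on_def by (auto intro: tendsto_mult_group)

lemma continuous_on_inv_group [continuous_intros]:
  "continuous_on S f \<Longrightarrow> continuous_on S (\<lambda>x. inv (f x))"
  unfolding continuous_on_def by (auto intro: tendsto_inv_group)

lemma continuous_mult_group [continuous_intros]:
  "continuous F f \<Longrightarrow> continuous F g \<Longrightarrow> continuous F (\<lambda>x. f x \<otimes> g x)"
  unfolding continuous_def by (rule tendsto_mult_group)

lemma continuous_inv_group [continuous_intros]:
  "continuous F f \<Longrightarrow> continuous F (\<lambda>x. inv (f x))"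
  unfolding continuous_def by (rule tendsto_inv_group)

text \<open>Smoothness is given in terms of the inverse of the product chart
  \<open>map_prod \<psi> \<psi>'\<close>; on \<open>\<Omega>\<close> that inverse splits into the
  inverses of the two factors, and \<open>Ck_on_cong\<close> transfers the smoothness.\<close>

lemma mult_in_charts:
  assumes "(U, \<psi>) \<in> A" "(U', \<psi>') \<in> A" "(U'', \<psi>'') \<in> A"
  defines "\<Omega> \<equiv> {p. fst p \<in> \<psi> ` U \<and> snd p \<in> \<psi>' ` U' \<and> inv_into U \<psi> (fst p) \<otimes> inv_into U' \<psi>' (snd p) \<in> U''}"
  shows "open \<Omega>"
    and "smooth_on (\<lambda>p. \<psi>'' (inv_into U \<psi> (fst p) \<otimes> inv_into U' \<psi>' (snd p))) \<Omega>"
proof -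
  note c = chartD[OF assms(1)] and c' = chartD[OF assms(2)] and c'' = chartD[OF assms(3)]
  let ?h = "\<lambda>p. inv_into U \<psi> (fst p) \<otimes> inv_into U' \<psi>' (snd p)"
  have "continuous_on (\<psi> ` U \<times> \<psi>' ` U') ?h"
    by (intro continuous_intros continuous_on_compose2[OF c(4)] continuous_on_compose2[OF c'(4)]) auto
  then have "open ((\<psi> ` U \<times> \<psi>' ` U') \<inter> ?h -` U'')"
    using c c' c''(1) by (intro continuous_open_preimage open_Times) auto
  moreover have "(\<psi> ` U \<times> \<psi>' ` U') \<inter> ?h -` U'' = \<Omega>" by (auto simp: \<Omega>_def)
  ultimately show op: "open \<Omega>" by simp
  have inj: "inj_on \<psi> U" "inj_on \<psi>' U'"
    using c(5) c'(5) by (metis inj_onI)+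
  have inv_eq: "inv_into (U \<times> U') (map_prod \<psi> \<psi>') (\<psi> a, \<psi>' b) = (a, b)" if "a \<in> U" "b \<in> U'" for a b
    using inv_into_f_f[of "map_prod \<psi> \<psi>'" "U \<times> U'" "(a, b)"] map_prod_inj_on[OF inj] that by simp
  have im: "map_prod \<psi> \<psi>' ` ((U \<times> U') \<inter> (\<lambda>(x, y). x \<otimes> y) -` U'') = \<Omega>"
  proof (intro equalityI subsetI)
    fix p assume "p \<in> \<Omega>"
    then show "p \<in> map_prod \<psi> \<psi>' ` ((U \<times> U') \<inter> (\<lambda>(x, y). x \<otimes> y) -` U'')"
      unfolding \<Omega>_def using c(5) c'(5)
      by (intro image_eqI[of _ _ "(inv_into U \<psi> (fst p), inv_into U' \<psi>' (snd p))"])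
        (auto simp: prod_eq_iff)
  qed (use c(5) c'(5) in \<open>auto simp: \<Omega>_def\<close>)
  have "(U \<times> U', map_prod \<psi> \<psi>') \<in> prod_atlas A A"
    unfolding prod_atlas_def using assms(1,2) by blast
  then have "smooth_on (\<lambda>x. \<psi>'' ((\<lambda>(x, y). x \<otimes> y) (inv_into (U \<times> U') (map_prod \<psi> \<psi>') x))) \<Omega>"
    using smooth_mult assms(3) im unfolding smooth_map_def by fastforce
  then have sm: "Ck_on k (\<lambda>x. \<psi>'' ((\<lambda>(x, y). x \<otimes> y) (inv_into (U \<times> U') (map_prod \<psi> \<psi>') x))) \<Omega>" for k
    unfolding smooth_on_def by blast
  have "\<psi>'' ((\<lambda>(x, y). x \<otimes> y) (inv_into (U \<times> U') (map_prod \<psi> \<psi>') p)) = \<psi>'' (?h p)" if "p \<in> \<Omega>" for p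
  proof -
    have "fst p \<in> \<psi> ` U" "snd p \<in> \<psi>' ` U'" using that by (simp_all add: \<Omega>_def)
    then obtain a b where "p = (\<psi> a, \<psi>' b)" "a \<in> U" "b \<in> U'"
      by (metis imageE prod.collapse)
    then show ?thesis using inv_eq c(5) c'(5) by simp
  qed
  from Ck_on_cong[OF op this sm] show "smooth_on (\<lambda>p. \<psi>'' (?h p)) \<Omega>"
    unfolding smooth_on_def by blast
qed

lemma smooth_on_differentiable: "smooth_on f S \<Longrightarrow> x \<in> S \<Longrightarrow> f differentiable (at x)"
  unfolding smooth_on_def by (drule spec[of _ "Suc 0"]) simp

text \<open>The smooth multiplication is restricted to a slice: the first argument is frozen at the
  coordinates of \<open>g\<close> in an auxiliary chart.\<close>

lemma left_mult_differentiable: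
  assumes "(U, \<psi>) \<in> A" "(U', \<psi>') \<in> A" "a \<in> U" "g \<otimes> a \<in> U'"
  shows "(\<lambda>y. \<psi>' (g \<otimes> inv_into U \<psi> y)) differentiable (at (\<psi> a))"
proof -
  obtain V \<xi> where V: "(V, \<xi>) \<in> A" "g \<in> V" by (rule chart_at)
  have "(\<lambda>p. \<psi>' (inv_into V \<xi> (fst p) \<otimes> inv_into U \<psi> (snd p))) differentiable (at (\<xi> g, \<psi> a))"
    using mult_in_charts(2)[OF V(1) assms(1,2)] V assms
    by (intro smooth_on_differentiable) (auto simp: chartD(5)[OF V(1)] chartD(5)[OF assms(1)])
  then have "(\<lambda>p. \<psi>' (inv_into V \<xi> (fst p) \<otimes> inv_into U \<psi> (snd p))) \<circ> (\<lambda>y. (\<xi> g, y)) differentiable (at (\<psi> a))"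
    by (intro differentiable_chain_at) (auto simp: differentiable_def intro!: derivative_eq_intros)
  then show ?thesis by (simp add: o_def chartD(5)[OF V])
qed

lemma right_mult_differentiable:
  assumes "(U, \<psi>) \<in> A" "(U', \<psi>') \<in> A" "a \<in> U" "a \<otimes> g \<in> U'"
  shows "(\<lambda>y. \<psi>' (inv_into U \<psi> y \<otimes> g)) differentiable (at (\<psi> a))"
proof -
  obtain V \<xi> where V: "(V, \<xi>) \<in> A" "g \<in> V" by (rule chart_at)
  have "(\<lambda>p. \<psi>' (inv_into U \<psi> (fst p) \<otimes> inv_into V \<xi> (snd p))) differentiable (at (\<psi> a, \<xi> g))"
    using mult_in_charts(2)[OF assms(1) V(1) assms(2)] V assms
    by (intro smooth_on_differentiable) (auto simp: chartD(5)[OF V(1)] chartD(5)[OF assms(1)])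
  then have "(\<lambda>p. \<psi>' (inv_into U \<psi> (fst p) \<otimes> inv_into V \<xi> (snd p))) \<circ> (\<lambda>y. (y, \<xi> g)) differentiable (at (\<psi> a))"
    by (intro differentiable_chain_at) (auto simp: differentiable_def intro!: derivative_eq_intros)
  then show ?thesis by (simp add: o_def chartD(5)[OF V])
qed

lemma smooth_map_differentiable:
  assumes "smooth_map A A f" "(U, \<psi>) \<in> A" "(U', \<psi>') \<in> A" "a \<in> U" "f a \<in> U'"
  shows "(\<lambda>y. \<psi>' (f (inv_into U \<psi> y))) differentiable (at (\<psi> a))"
proof (rule smooth_on_differentiable)
  show "smooth_on (\<lambda>y. \<psi>' (f (inv_into U \<psi> y))) (\<psi> ` (U \<inter> f -` U'))"
    using assms(1-3) unfolding smooth_map_def by blast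
qed (use assms in auto)

end

context lie_group_with_chart
begin

section \<open>Multiplication in the chart at the identity\<close>

abbreviation chart_inv :: "'e \<Rightarrow> 'g" ("\<phi>") where "\<phi> \<equiv> inv_into U\<^sub>0 \<kappa>\<^sub>0"

abbreviation origin :: 'e ("\<o>") where "\<o> \<equiv> \<kappa>\<^sub>0 \<one>"

lemmas chart0 = chartD[OF chart_at_one(1)]
lemmas chart0_inv_tendsto = inv_chart_tendsto[OF chart_at_one(1)]

lemma \<phi>_origin [simp]: "\<phi> \<o> = \<one>"
  using chart0(5) chart_at_one(2) by simp

lemma origin_in: "\<o> \<in> \<kappa>\<^sub>0 ` U\<^sub>0"
  using chart_at_one by simp

lemma \<phi>_tendsto_one: "(\<phi> \<longlongrightarrow> \<one>) (at \<o>)"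
  using chart0_inv_tendsto[of "\<lambda>x. x" \<one>] chart_at_one by simp

definition local_mult :: "'e \<times> 'e \<Rightarrow> 'e" ("\<mu>") where
  "\<mu> p = \<kappa>\<^sub>0 (\<phi> (fst p) \<otimes> \<phi> (snd p))"

definition local_dom :: "('e \<times> 'e) set" ("\<Omega>") where
  "\<Omega> = {p. fst p \<in> \<kappa>\<^sub>0 ` U\<^sub>0 \<and> snd p \<in> \<kappa>\<^sub>0 ` U\<^sub>0 \<and> \<phi> (fst p) \<otimes> \<phi> (snd p) \<in> U\<^sub>0}"

abbreviation d\<mu> :: "'e \<times> 'e \<Rightarrow> 'e \<times> 'e \<Rightarrow> 'e" where
  "d\<mu> p \<equiv> frechet_derivative \<mu> (at p)"

lemma open_\<Omega>: "open \<Omega>"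
  and Ck_\<mu>: "Ck_on k \<mu> \<Omega>"
  using mult_in_charts[OF chart_at_one(1) chart_at_one(1) chart_at_one(1)]
  unfolding local_dom_def local_mult_def[abs_def] smooth_on_def by auto

lemma in_\<Omega> [intro]: "a \<in> U\<^sub>0 \<Longrightarrow> b \<in> U\<^sub>0 \<Longrightarrow> a \<otimes> b \<in> U\<^sub>0 \<Longrightarrow> (\<kappa>\<^sub>0 a, \<kappa>\<^sub>0 b) \<in> \<Omega>"
  by (simp add: local_dom_def chart0)

lemma in_\<Omega>_origin:
  assumes "x \<in> \<kappa>\<^sub>0 ` U\<^sub>0"
  shows "(x, \<o>) \<in> \<Omega>" "(\<o>, x) \<in> \<Omega>"
  using assms chart_at_one by (auto intro!: in_\<Omega>)

lemma \<mu>_chart: "a \<in> U\<^sub>0 \<Longrightarrow> b \<in> U\<^sub>0 \<Longrightarrow> \<mu> (\<kappa>\<^sub>0 a, \<kappa>\<^sub>0 b) = \<kappa>\<^sub>0 (a \<otimes> b)"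
  by (simp add: local_mult_def chart0)

lemma \<mu>_origin:
  assumes "x \<in> \<kappa>\<^sub>0 ` U\<^sub>0"
  shows "\<mu> (x, \<o>) = x" "\<mu> (\<o>, x) = x"
  using assms chart_at_one by (auto simp: \<mu>_chart)

lemma \<mu>_has_derivative: "p \<in> \<Omega> \<Longrightarrow> (\<mu> has_derivative d\<mu> p) (at p)"
  using Ck_\<mu>[of "Suc 0"] frechet_derivative_works by auto

lemma linear_d\<mu>: "p \<in> \<Omega> \<Longrightarrow> linear (d\<mu> p)"
  using \<mu>_has_derivative has_derivative_linear by blast

lemma \<mu>_has_derivative_compose:
  assumes "(f has_derivative f') (at x)" "(g has_derivative g') (at x)" "(f x, g x) \<in> \<Omega>"
  shows "((\<lambda>y. \<mu> (f y, g y)) has_derivative (\<lambda>h. d\<mu> (f x, g x) (f' h, g' h))) (at x)"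
  using has_derivative_compose[OF has_derivative_Pair[OF assms(1,2)] \<mu>_has_derivative[OF assms(3)]] .

lemma d\<mu>_origin_left:
  assumes "x \<in> \<kappa>\<^sub>0 ` U\<^sub>0"
  shows "d\<mu> (x, \<o>) (v, 0) = v"
proof -
  have "((\<lambda>y. \<mu> (y, \<o>)) has_derivative (\<lambda>h. d\<mu> (x, \<o>) (h, 0))) (at x)"
    using in_\<Omega>_origin[OF assms] by (intro \<mu>_has_derivative_compose) (auto intro!: derivative_eq_intros)
  moreover have "((\<lambda>y. \<mu> (y, \<o>)) has_derivative (\<lambda>h. h)) (at x)"
    by (rule has_derivative_transform_within_open[OF has_derivative_ident chart0(2) assms])
      (simp add: \<mu>_origin)
  ultimately show ?thesis using has_derivative_unique by metis
qed

lemma d\<mu>_origin_right: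
  assumes "x \<in> \<kappa>\<^sub>0 ` U\<^sub>0"
  shows "d\<mu> (\<o>, x) (0, v) = v"
proof -
  have "((\<lambda>y. \<mu> (\<o>, y)) has_derivative (\<lambda>h. d\<mu> (\<o>, x) (0, h))) (at x)"
    using in_\<Omega>_origin[OF assms] by (intro \<mu>_has_derivative_compose) (auto intro!: derivative_eq_intros)
  moreover have "((\<lambda>y. \<mu> (\<o>, y)) has_derivative (\<lambda>h. h)) (at x)"
    by (rule has_derivative_transform_within_open[OF has_derivative_ident chart0(2) assms])
      (simp add: \<mu>_origin)
  ultimately show ?thesis using has_derivative_unique by metis
qed

text \<open>By the unit laws \<open>\<mu>\<close> is the identity in each argument separately, and
  linearity adds the two contributions.\<close>

lemma d\<mu>_origin: "d\<mu> (\<o>, \<o>) (u, v) = u + v"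
  using d\<mu>_origin_left[OF origin_in, of u] d\<mu>_origin_right[OF origin_in, of v]
    linear_add[OF linear_d\<mu>[OF in_\<Omega>_origin(1)[OF origin_in]], of "(u, 0)" "(0, v)"] by simp

text \<open>Continuity is not implied by the second conjunct, since \<open>\<kappa>\<^sub>0\<close> is arbitrary outside \<open>U\<^sub>0\<close>.\<close>

definition has_log_derivative :: "('a::real_normed_vector \<Rightarrow> 'g) \<Rightarrow> ('a \<Rightarrow> 'e) \<Rightarrow> 'a \<Rightarrow> bool" where
  "has_log_derivative f L x \<longleftrightarrow>
     isCont f x \<and> ((\<lambda>y. \<kappa>\<^sub>0 (inv (f x) \<otimes> f y)) has_derivative L) (at x)"

lemma isCont_eventually_in_open:
  fixes f :: "'a::real_normed_vector \<Rightarrow> 'g"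
  assumes "isCont f x" "open U" "f x \<in> U"
  shows "\<forall>\<^sub>F y in at x. f y \<in> U"
  using assms unfolding isCont_def by (rule topological_tendstoD)

lemma left_translation_derivative:
  assumes "(U, \<psi>) \<in> A" "g \<in> U"
  shows "((\<lambda>y. \<psi> (g \<otimes> \<phi> y)) has_derivative (\<lambda>v. left_inv_field \<psi> v g)) (at \<o>)"
  unfolding left_inv_field_def using left_mult_differentiable[OF chart_at_one(1) assms(1) chart_at_one(2), of g]
  by (simp add: assms frechet_derivative_works)

text \<open>Translating by \<open>inv g\<close> undoes translating by \<open>g\<close>, so by the
  chain rule its derivative \<open>\<beta>\<close> is a left inverse of
  \<open>v \<mapsto> left_inv_field \<psi> v g\<close>. It converts chart derivatives into
  logarithmic ones.\<close>

lemma left_translation_back: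
  assumes "(U, \<psi>) \<in> A" "g \<in> U"
  obtains \<beta> where "((\<lambda>z. \<kappa>\<^sub>0 (inv g \<otimes> inv_into U \<psi> z)) has_derivative \<beta>) (at (\<psi> g))"
    "\<And>v. \<beta> (left_inv_field \<psi> v g) = v"
proof -
  let ?\<beta> = "frechet_derivative (\<lambda>z. \<kappa>\<^sub>0 (inv g \<otimes> inv_into U \<psi> z)) (at (\<psi> g))"
  have d: "((\<lambda>z. \<kappa>\<^sub>0 (inv g \<otimes> inv_into U \<psi> z)) has_derivative ?\<beta>) (at (\<psi> g))"
    using left_mult_differentiable[OF assms(1) chart_at_one(1) assms(2), of "inv g"] chart_at_one
    by (simp add: frechet_derivative_works)
  have "((\<lambda>y. \<kappa>\<^sub>0 (inv g \<otimes> inv_into U \<psi> (\<psi> (g \<otimes> \<phi> y)))) has_derivative (\<lambda>v. ?\<beta> (left_inv_field \<psi> v g))) (at \<o>)"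
    by (rule has_derivative_compose[OF left_translation_derivative[OF assms]]) (use d in simp)
  moreover have "((\<lambda>y. \<kappa>\<^sub>0 (inv g \<otimes> inv_into U \<psi> (\<psi> (g \<otimes> \<phi> y)))) has_derivative (\<lambda>v. v)) (at \<o>)"
  proof (rule has_derivative_transform_eventually[OF has_derivative_ident])
    have "((\<lambda>y. g \<otimes> \<phi> y) \<longlongrightarrow> g \<otimes> \<one>) (at \<o>)"
      by (intro tendsto_intros \<phi>_tendsto_one)
    then have "\<forall>\<^sub>F y in at \<o>. g \<otimes> \<phi> y \<in> U"
      using assms(2) chartD(1)[OF assms(1)] by (auto dest: topological_tendstoD)
    moreover have "\<forall>\<^sub>F y in at \<o>. y \<in> \<kappa>\<^sub>0 ` U\<^sub>0"
      using chart0(2) origin_in by (rule eventually_at_in_open')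
    ultimately show "\<forall>\<^sub>F y in at \<o>. y = \<kappa>\<^sub>0 (inv g \<otimes> inv_into U \<psi> (\<psi> (g \<otimes> \<phi> y)))"
      by eventually_elim (auto simp: chartD(5)[OF assms(1)] chart0)
  qed (auto simp: chartD(5)[OF assms] assms(2))
  ultimately have "(\<lambda>v. ?\<beta> (left_inv_field \<psi> v g)) = (\<lambda>v. v)" by (rule has_derivative_unique)
  then show ?thesis using that[OF d] by metis
qed

text \<open>Together with \<open>has_log_derivative_in_chart\<close> this identifies the logarithmic
  derivative with the ordinary one in an arbitrary chart, expressed through left-invariant
  fields.\<close>

lemma has_log_derivative_from_chart:
  fixes f :: "'a::real_normed_vector \<Rightarrow> 'g"
  assumes "(U, \<psi>) \<in> A" "f x \<in> U" "isCont f x"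
    and "((\<lambda>y. \<psi> (f y)) has_derivative (\<lambda>h. left_inv_field \<psi> (L h) (f x))) (at x)"
  shows "has_log_derivative f L x"
proof -
  obtain \<beta> where \<beta>: "((\<lambda>z. \<kappa>\<^sub>0 (inv f x \<otimes> inv_into U \<psi> z)) has_derivative \<beta>) (at (\<psi> (f x)))"
    "\<And>v. \<beta> (left_inv_field \<psi> v (f x)) = v"
    using left_translation_back[OF assms(1,2)] by blast
  have "((\<lambda>y. \<kappa>\<^sub>0 (inv f x \<otimes> inv_into U \<psi> (\<psi> (f y)))) has_derivative (\<lambda>h. \<beta> (left_inv_field \<psi> (L h) (f x)))) (at x)"
    by (rule has_derivative_compose[OF assms(4) \<beta>(1)])
  then have "((\<lambda>y. \<kappa>\<^sub>0 (inv f x \<otimes> f y)) has_derivative (\<lambda>h. \<beta> (left_inv_field \<psi> (L h) (f x)))) (at x)"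
  proof (rule has_derivative_transform_eventually)
    show "\<forall>\<^sub>F y in at x. \<kappa>\<^sub>0 (inv f x \<otimes> inv_into U \<psi> (\<psi> (f y))) = \<kappa>\<^sub>0 (inv f x \<otimes> f y)"
      using isCont_eventually_in_open[OF assms(3) chartD(1)[OF assms(1)] assms(2)]
      by eventually_elim (simp add: chartD(5)[OF assms(1)])
  qed (auto simp: chartD(5)[OF assms(1,2)])
  then show ?thesis unfolding has_log_derivative_def using assms(3) \<beta>(2) by simp
qed

lemma log_derivative_in_U\<^sub>0:
  fixes f :: "'a::real_normed_vector \<Rightarrow> 'g"
  assumes "isCont f x"
  shows "\<forall>\<^sub>F y in at x. inv f x \<otimes> f y \<in> U\<^sub>0"
  by (rule isCont_eventually_in_open) (use assms chart0(1) chart_at_one in \<open>auto intro!: continuous_intros\<close>)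

lemma has_log_derivative_in_chart:
  fixes f :: "'a::real_normed_vector \<Rightarrow> 'g"
  assumes "(U, \<psi>) \<in> A" "f x \<in> U" "has_log_derivative f L x"
  shows "((\<lambda>y. \<psi> (f y)) has_derivative (\<lambda>h. left_inv_field \<psi> (L h) (f x))) (at x)"
proof -
  have L: "isCont f x" "((\<lambda>y. \<kappa>\<^sub>0 (inv (f x) \<otimes> f y)) has_derivative L) (at x)"
    using assms(3) by (auto simp: has_log_derivative_def)
  have "((\<lambda>y. \<psi> (f x \<otimes> \<phi> (\<kappa>\<^sub>0 (inv f x \<otimes> f y)))) has_derivative (\<lambda>h. left_inv_field \<psi> (L h) (f x))) (at x)"
    by (rule has_derivative_compose[OF L(2)]) (use left_translation_derivative[OF assms(1,2)] in simp)
  then show ?thesis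
  proof (rule has_derivative_transform_eventually)
    show "\<forall>\<^sub>F y in at x. \<psi> (f x \<otimes> \<phi> (\<kappa>\<^sub>0 (inv f x \<otimes> f y))) = \<psi> (f y)"
      using log_derivative_in_U\<^sub>0[OF L(1)] by eventually_elim (simp add: chart0)
  qed (use chart_at_one in auto)
qed

section \<open>The adjoint action; logarithmic derivatives of products and inverses\<close>

definition conj_chart :: "'g \<Rightarrow> 'e \<Rightarrow> 'e" where
  "conj_chart g z = \<kappa>\<^sub>0 (g \<otimes> \<phi> z \<otimes> inv g)"

definition Ad :: "'g \<Rightarrow> 'e \<Rightarrow> 'e" where
  "Ad g = frechet_derivative (conj_chart g) (at \<o>)"

lemma conj_chart_origin [simp]: "conj_chart g \<o> = \<o>"
  by (simp add: conj_chart_def)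

lemma conj_tendsto_one: "((\<lambda>y. g \<otimes> \<phi> y \<otimes> inv g) \<longlongrightarrow> \<one>) (at \<o>)"
proof -
  have "((\<lambda>y. g \<otimes> \<phi> y \<otimes> inv g) \<longlongrightarrow> g \<otimes> \<one> \<otimes> inv g) (at \<o>)"
    by (intro tendsto_intros \<phi>_tendsto_one)
  then show ?thesis by simp
qed

text \<open>Since \<open>g\<close> may lie outside \<open>U\<^sub>0\<close>, conjugation is factored
  through a chart around \<open>g\<close>: left translation into that chart, then right
  multiplication by \<open>inv g\<close> back to the identity.\<close>

lemma Ad_has_derivative: "(conj_chart g has_derivative Ad g) (at \<o>)"
proof -
  obtain U \<psi> where c: "(U, \<psi>) \<in> A" "g \<in> U" by (rule chart_at)
  have "(\<lambda>z. \<kappa>\<^sub>0 (inv_into U \<psi> z \<otimes> inv g)) differentiable (at (\<psi> g))"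
    using right_mult_differentiable[OF c(1) chart_at_one(1) c(2), of "inv g"] chart_at_one by simp
  then obtain D where "((\<lambda>z. \<kappa>\<^sub>0 (inv_into U \<psi> z \<otimes> inv g)) has_derivative D) (at (\<psi> (g \<otimes> \<phi> \<o>)))"
    unfolding differentiable_def by auto
  from has_derivative_compose[OF left_translation_derivative[OF c] this]
  have "((\<lambda>y. \<kappa>\<^sub>0 (inv_into U \<psi> (\<psi> (g \<otimes> \<phi> y)) \<otimes> inv g)) has_derivative (\<lambda>v. D (left_inv_field \<psi> v g))) (at \<o>)" .
  then have "(conj_chart g has_derivative (\<lambda>v. D (left_inv_field \<psi> v g))) (at \<o>)"
  proof (rule has_derivative_transform_eventually)
    have "((\<lambda>y. g \<otimes> \<phi> y) \<longlongrightarrow> g \<otimes> \<one>) (at \<o>)"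
      by (intro tendsto_intros \<phi>_tendsto_one)
    then have "\<forall>\<^sub>F y in at \<o>. g \<otimes> \<phi> y \<in> U"
      using c chartD(1)[OF c(1)] by (auto dest: topological_tendstoD)
    then show "\<forall>\<^sub>F y in at \<o>. \<kappa>\<^sub>0 (inv_into U \<psi> (\<psi> (g \<otimes> \<phi> y)) \<otimes> inv g) = conj_chart g y"
      by eventually_elim (simp add: conj_chart_def chartD(5)[OF c(1)])
  qed (simp_all add: conj_chart_def chartD(5)[OF c])
  then show ?thesis unfolding Ad_def
    by (auto simp: differentiable_def simp flip: frechet_derivative_works)
qed

lemma linear_Ad: "linear (Ad g)"
  using Ad_has_derivative has_derivative_linear by blast

lemma Ad_mult: "Ad (g \<otimes> h) v = Ad g (Ad h v)"
proof -
  have "((\<lambda>y. conj_chart g (conj_chart h y)) has_derivative (\<lambda>v. Ad g (Ad h v))) (at \<o>)"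
    by (rule has_derivative_compose[OF Ad_has_derivative]) (simp add: Ad_has_derivative)
  then have "(conj_chart (g \<otimes> h) has_derivative (\<lambda>v. Ad g (Ad h v))) (at \<o>)"
  proof (rule has_derivative_transform_eventually)
    have "\<forall>\<^sub>F y in at \<o>. h \<otimes> \<phi> y \<otimes> inv h \<in> U\<^sub>0"
      using conj_tendsto_one[of h] chart0(1) chart_at_one(2) by (rule topological_tendstoD)
    then show "\<forall>\<^sub>F y in at \<o>. conj_chart g (conj_chart h y) = conj_chart (g \<otimes> h) y"
      by eventually_elim (simp add: conj_chart_def chart0 m_assoc inv_mult_group)
  qed auto
  then show ?thesis using Ad_has_derivative has_derivative_unique by metis
qed

lemma Ad_one [simp]: "Ad \<one> v = v"
proof -
  have "(conj_chart \<one> has_derivative (\<lambda>v. v)) (at \<o>)"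
    by (rule has_derivative_transform_within_open[OF has_derivative_ident chart0(2) origin_in])
      (auto simp: conj_chart_def chart0)
  then show ?thesis using Ad_has_derivative has_derivative_unique by metis
qed

lemma Ad_inv [simp]: "Ad (inv g) (Ad g v) = v" "Ad g (Ad (inv g) v) = v"
  using Ad_mult[of "inv g" g v] Ad_mult[of g "inv g" v] by simp_all

text \<open>The increment of the product is the increment of \<open>f\<close>, conjugated by
  \<open>inv (g x)\<close>, times the increment of \<open>g\<close>; near the identity
  \<open>\<mu>\<close> is addition to first order. The conjugation is the source of all the
  \<open>Ad (inv q)\<close> below.\<close>

lemma has_log_derivative_mult:
  fixes f g :: "'a::real_normed_vector \<Rightarrow> 'g"
  assumes "has_log_derivative f L x" "has_log_derivative g K x"
  shows "has_log_derivative (\<lambda>y. f y \<otimes> g y) (\<lambda>h. Ad (inv (g x)) (L h) + K h) x"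
proof -
  have f: "isCont f x" "((\<lambda>y. \<kappa>\<^sub>0 (inv (f x) \<otimes> f y)) has_derivative L) (at x)"
    and g: "isCont g x" "((\<lambda>y. \<kappa>\<^sub>0 (inv (g x) \<otimes> g y)) has_derivative K) (at x)"
    using assms by (auto simp: has_log_derivative_def)
  have c: "((\<lambda>y. conj_chart (inv (g x)) (\<kappa>\<^sub>0 (inv (f x) \<otimes> f y))) has_derivative (\<lambda>h. Ad (inv (g x)) (L h))) (at x)"
    by (rule has_derivative_compose[OF f(2)]) (simp add: Ad_has_derivative)
  have "((\<lambda>y. \<mu> (conj_chart (inv (g x)) (\<kappa>\<^sub>0 (inv (f x) \<otimes> f y)), \<kappa>\<^sub>0 (inv (g x) \<otimes> g y))) has_derivative
    (\<lambda>h. d\<mu> (conj_chart (inv (g x)) (\<kappa>\<^sub>0 (inv (f x) \<otimes> f x)), \<kappa>\<^sub>0 (inv (g x) \<otimes> g x)) (Ad (inv (g x)) (L h), K h))) (at x)"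
    by (rule \<mu>_has_derivative_compose[OF c g(2)]) (simp add: in_\<Omega>_origin origin_in)
  then have "((\<lambda>y. \<mu> (conj_chart (inv (g x)) (\<kappa>\<^sub>0 (inv (f x) \<otimes> f y)), \<kappa>\<^sub>0 (inv (g x) \<otimes> g y))) has_derivative
    (\<lambda>h. Ad (inv (g x)) (L h) + K h)) (at x)" by (simp add: d\<mu>_origin)
  then have "((\<lambda>y. \<kappa>\<^sub>0 (inv (f x \<otimes> g x) \<otimes> (f y \<otimes> g y))) has_derivative (\<lambda>h. Ad (inv (g x)) (L h) + K h)) (at x)"
  proof (rule has_derivative_transform_eventually)
    have "\<forall>\<^sub>F y in at x. inv (g x) \<otimes> (inv (f x) \<otimes> f y) \<otimes> g x \<in> U\<^sub>0"
      by (rule isCont_eventually_in_open)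
        (use f(1) chart0(1) chart_at_one in \<open>auto intro!: continuous_intros\<close>)
    with log_derivative_in_U\<^sub>0[OF f(1)] log_derivative_in_U\<^sub>0[OF g(1)]
    show "\<forall>\<^sub>F y in at x. \<mu> (conj_chart (inv (g x)) (\<kappa>\<^sub>0 (inv (f x) \<otimes> f y)), \<kappa>\<^sub>0 (inv (g x) \<otimes> g y)) =
        \<kappa>\<^sub>0 (inv (f x \<otimes> g x) \<otimes> (f y \<otimes> g y))"
      by eventually_elim (simp add: conj_chart_def chart0 \<mu>_chart m_assoc inv_mult_group)
    show "\<mu> (conj_chart (inv (g x)) (\<kappa>\<^sub>0 (inv (f x) \<otimes> f x)), \<kappa>\<^sub>0 (inv (g x) \<otimes> g x)) =
        \<kappa>\<^sub>0 (inv (f x \<otimes> g x) \<otimes> (f x \<otimes> g x))"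
      by (simp add: \<mu>_origin origin_in)
  qed auto
  then show ?thesis using f(1) g(1) unfolding has_log_derivative_def by (auto intro!: continuous_intros)
qed

definition inv_chart :: "'e \<Rightarrow> 'e" where
  "inv_chart z = \<kappa>\<^sub>0 (inv (\<phi> z))"

lemma inv_chart_origin [simp]: "inv_chart \<o> = \<o>"
  by (simp add: inv_chart_def)

text \<open>Differentiating \<open>y \<otimes> inv y = \<one>\<close> at the identity leaves
  \<open>h + D h = 0\<close>.\<close>

lemma inv_chart_has_derivative: "(inv_chart has_derivative (\<lambda>v. - v)) (at \<o>)"
proof -
  have "inv_chart differentiable (at \<o>)"
    using smooth_map_differentiable[OF smooth_inv chart_at_one(1) chart_at_one(1) chart_at_one(2)] chart_at_one
    by (simp add: inv_chart_def[abs_def])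
  then obtain D where D: "(inv_chart has_derivative D) (at \<o>)" unfolding differentiable_def by blast
  have "((\<lambda>y. \<mu> (y, inv_chart y)) has_derivative (\<lambda>h. d\<mu> (\<o>, inv_chart \<o>) (h, D h))) (at \<o>)"
    by (intro \<mu>_has_derivative_compose D) (auto intro!: derivative_eq_intros in_\<Omega>_origin origin_in)
  then have "((\<lambda>y. \<mu> (y, inv_chart y)) has_derivative (\<lambda>h. h + D h)) (at \<o>)"
    by (simp add: d\<mu>_origin)
  moreover have "((\<lambda>y. \<mu> (y, inv_chart y)) has_derivative (\<lambda>h. 0)) (at \<o>)"
  proof (rule has_derivative_transform_eventually[OF has_derivative_const])
    have "((\<lambda>y. inv (\<phi> y)) \<longlongrightarrow> inv \<one>) (at \<o>)"
      by (intro tendsto_intros \<phi>_tendsto_one)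
    then have "\<forall>\<^sub>F y in at \<o>. inv (\<phi> y) \<in> U\<^sub>0"
      using chart0(1) chart_at_one(2) by (auto dest: topological_tendstoD)
    moreover have "\<forall>\<^sub>F y in at \<o>. y \<in> \<kappa>\<^sub>0 ` U\<^sub>0"
      using chart0(2) origin_in by (rule eventually_at_in_open')
    ultimately show "\<forall>\<^sub>F y in at \<o>. \<o> = \<mu> (y, inv_chart y)"
      by eventually_elim (auto simp: inv_chart_def \<mu>_chart chart0)
  qed (auto simp: \<mu>_origin origin_in)
  ultimately have "(\<lambda>h. h + D h) = (\<lambda>h. 0)" by (rule has_derivative_unique)
  then have "D = (\<lambda>v. - v)" by (metis add_eq_0_iff)
  with D show ?thesis by simp
qed

text \<open>The increment \<open>f x \<otimes> inv (f y)\<close> is the inverse of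
  \<open>inv (f x) \<otimes> f y\<close>, conjugated by \<open>f x\<close>.\<close>

lemma has_log_derivative_inv:
  fixes f :: "'a::real_normed_vector \<Rightarrow> 'g"
  assumes "has_log_derivative f L x"
  shows "has_log_derivative (\<lambda>y. inv (f y)) (\<lambda>h. - Ad (f x) (L h)) x"
proof -
  have f: "isCont f x" "((\<lambda>y. \<kappa>\<^sub>0 (inv (f x) \<otimes> f y)) has_derivative L) (at x)"
    using assms by (auto simp: has_log_derivative_def)
  have "((\<lambda>y. inv_chart (\<kappa>\<^sub>0 (inv (f x) \<otimes> f y))) has_derivative (\<lambda>h. - L h)) (at x)"
    by (rule has_derivative_compose[OF f(2)]) (simp add: inv_chart_has_derivative)
  then have "((\<lambda>y. conj_chart (f x) (inv_chart (\<kappa>\<^sub>0 (inv (f x) \<otimes> f y)))) has_derivative (\<lambda>h. Ad (f x) (- L h))) (at x)"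
    by (rule has_derivative_compose) (simp add: Ad_has_derivative)
  then have "((\<lambda>y. \<kappa>\<^sub>0 (inv (inv (f x)) \<otimes> inv (f y))) has_derivative (\<lambda>h. Ad (f x) (- L h))) (at x)"
  proof (rule has_derivative_transform_eventually)
    have "\<forall>\<^sub>F y in at x. inv (inv (f x) \<otimes> f y) \<in> U\<^sub>0"
      by (rule isCont_eventually_in_open)
        (use f(1) chart0(1) chart_at_one in \<open>auto intro!: continuous_intros\<close>)
    with log_derivative_in_U\<^sub>0[OF f(1)]
    show "\<forall>\<^sub>F y in at x. conj_chart (f x) (inv_chart (\<kappa>\<^sub>0 (inv (f x) \<otimes> f y))) = \<kappa>\<^sub>0 (inv (inv (f x)) \<otimes> inv (f y))"
      by eventually_elim (simp add: conj_chart_def inv_chart_def chart0 m_assoc inv_mult_group)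
  qed auto
  then show ?thesis using f(1) linear_neg[OF linear_Ad, of "f x"]
    unfolding has_log_derivative_def by (auto intro!: continuous_intros)
qed

end

section \<open>The adjoint action, the Lie bracket and integral curves\<close>

context lie_group_with_chart
begin

lemma left_inv_field_\<kappa>\<^sub>0:
  assumes "g \<in> U\<^sub>0"
  shows "left_inv_field \<kappa>\<^sub>0 v g = d\<mu> (\<kappa>\<^sub>0 g, \<o>) (0, v)"
proof -
  have "((\<lambda>y. \<mu> (\<kappa>\<^sub>0 g, y)) has_derivative (\<lambda>h. d\<mu> (\<kappa>\<^sub>0 g, \<o>) (0, h))) (at \<o>)"
    using assms by (intro \<mu>_has_derivative_compose) (auto intro!: derivative_eq_intros in_\<Omega>_origin)
  then have "((\<lambda>y. \<kappa>\<^sub>0 (g \<otimes> \<phi> y)) has_derivative (\<lambda>h. d\<mu> (\<kappa>\<^sub>0 g, \<o>) (0, h))) (at \<o>)"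
    by (simp add: local_mult_def chart0 assms)
  then show ?thesis unfolding left_inv_field_def using frechet_derivative_at by metis
qed

lemma linear_left_inv_field:
  assumes "(U, \<psi>) \<in> A" "g \<in> U"
  shows "linear (\<lambda>v. left_inv_field \<psi> v g)"
  using left_translation_derivative[OF assms] has_derivative_linear by blast

text \<open>The bracket and the derivative of \<open>Ad\<close> are both expressed through the mixed
  values of this second derivative, and are compared there.\<close>

abbreviation d2\<mu> :: "'e \<times> 'e \<Rightarrow> 'e \<times> 'e \<Rightarrow> 'e" where
  "d2\<mu> u \<equiv> frechet_derivative (\<lambda>p. d\<mu> p u) (at (\<o>, \<o>))"

lemma Ck_d\<mu>: "Ck_on k (\<lambda>p. d\<mu> p u) \<Omega>"
  using Ck_\<mu>[of "Suc k"] unfolding Ck_on.simps by blast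

lemma d\<mu>_has_derivative: "p \<in> \<Omega> \<Longrightarrow> ((\<lambda>p. d\<mu> p u) has_derivative frechet_derivative (\<lambda>p. d\<mu> p u) (at p)) (at p)"
  using Ck_d\<mu>[of "Suc 0" u] frechet_derivative_works unfolding Ck_on.simps by blast

lemma origin_pair_in_\<Omega>: "(\<o>, \<o>) \<in> \<Omega>"
  by (simp add: in_\<Omega>_origin origin_in)

lemma d2\<mu>_has_derivative: "((\<lambda>p. d\<mu> p u) has_derivative d2\<mu> u) (at (\<o>, \<o>))"
  by (rule d\<mu>_has_derivative[OF origin_pair_in_\<Omega>])

lemma linear_d2\<mu>: "linear (d2\<mu> u)"
  using d2\<mu>_has_derivative has_derivative_linear by blast

lemma d2\<mu>_symmetric: "d2\<mu> u v = d2\<mu> v u"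
  by (rule second_derivative_symmetric[OF open_\<Omega> origin_pair_in_\<Omega> Ck_\<mu>])

text \<open>Along the points \<open>(x, \<o>)\<close> the partial derivative in the first factor is
  constantly the identity.\<close>

lemma d2\<mu>_left: "d2\<mu> (w, 0) (v, 0) = 0"
proof -
  have "((\<lambda>x. d\<mu> (x, \<o>) (w, 0)) has_derivative (\<lambda>h. d2\<mu> (w, 0) (h, 0))) (at \<o>)"
    by (rule has_derivative_compose[where f = "\<lambda>x. (x, \<o>)", OF _ d2\<mu>_has_derivative])
      (auto intro!: derivative_eq_intros)
  moreover have "((\<lambda>x. d\<mu> (x, \<o>) (w, 0)) has_derivative (\<lambda>h. 0)) (at \<o>)"
    by (rule has_derivative_transform_within_open[OF has_derivative_const chart0(2) origin_in])
      (simp add: d\<mu>_origin_left)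
  ultimately show ?thesis using has_derivative_unique by metis
qed

lemma left_inv_field_has_derivative:
  "((\<lambda>x. left_inv_field \<kappa>\<^sub>0 v (\<phi> x)) has_derivative (\<lambda>h. d2\<mu> (0, v) (h, 0))) (at \<o>)"
proof (rule has_derivative_transform_within_open[OF _ chart0(2) origin_in])
  show "((\<lambda>x. d\<mu> (x, \<o>) (0, v)) has_derivative (\<lambda>h. d2\<mu> (0, v) (h, 0))) (at \<o>)"
    by (rule has_derivative_compose[where f = "\<lambda>x. (x, \<o>)", OF _ d2\<mu>_has_derivative])
      (auto intro!: derivative_eq_intros)
qed (auto simp: left_inv_field_\<kappa>\<^sub>0 chart0)

lemma lie_bracket_eq: "lie_bracket v w = d2\<mu> (0, w) (v, 0) - d2\<mu> (0, v) (w, 0)"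
proof -
  have "left_inv_field \<kappa>\<^sub>0 v \<one> = v" for v
    by (simp add: left_inv_field_\<kappa>\<^sub>0 chart_at_one d\<mu>_origin)
  then show ?thesis
    unfolding lie_bracket_def Let_def
    by (simp flip: frechet_derivative_at[OF left_inv_field_has_derivative])
qed

text \<open>In one of the two terms \<open>- v\<close> sits in the direction differentiated first;
  symmetry moves it to the argument in which linearity is known.\<close>

lemma lie_bracket_minus_left: "lie_bracket (- v) w = - lie_bracket v w"
proof -
  have "d2\<mu> (0, w) (- v, 0) = - d2\<mu> (0, w) (v, 0)" for v w
    using linear_neg[OF linear_d2\<mu>, of "(0, w)" "(v, 0)"] by simp
  moreover have "d2\<mu> (w, 0) (0, - v) = - d2\<mu> (w, 0) (0, v)" for v w
    using linear_neg[OF linear_d2\<mu>, of "(w, 0)" "(0, v)"] by simp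
  ultimately show ?thesis
    by (simp add: lie_bracket_eq d2\<mu>_symmetric[of _ "(w, 0)"])
qed

text \<open>Conjugation is written as two multiplications in the chart, which needs both
  \<open>g\<close> and its inverse in \<open>U\<^sub>0\<close>. The formula exhibits the dependence
  on \<open>g\<close>, so that \<open>Ad g\<close> can itself be shown continuous and be
  differentiated at the identity.\<close>

lemma Ad_in_chart:
  assumes "g \<in> U\<^sub>0" "inv g \<in> U\<^sub>0"
  shows "Ad g w = d\<mu> (\<kappa>\<^sub>0 g, \<kappa>\<^sub>0 (inv g)) (d\<mu> (\<kappa>\<^sub>0 g, \<o>) (0, w), 0)"
proof -
  have g: "\<mu> (\<kappa>\<^sub>0 g, \<o>) = \<kappa>\<^sub>0 g" using \<mu>_origin assms by blast
  have "((\<lambda>y. \<mu> (\<kappa>\<^sub>0 g, y)) has_derivative (\<lambda>h. d\<mu> (\<kappa>\<^sub>0 g, \<o>) (0, h))) (at \<o>)"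
    using assms by (intro \<mu>_has_derivative_compose) (auto intro!: derivative_eq_intros in_\<Omega>_origin)
  then have "((\<lambda>y. \<mu> (\<mu> (\<kappa>\<^sub>0 g, y), \<kappa>\<^sub>0 (inv g))) has_derivative
      (\<lambda>h. d\<mu> (\<mu> (\<kappa>\<^sub>0 g, \<o>), \<kappa>\<^sub>0 (inv g)) (d\<mu> (\<kappa>\<^sub>0 g, \<o>) (0, h), 0))) (at \<o>)"
    by (intro \<mu>_has_derivative_compose has_derivative_const) (use assms chart_at_one g in \<open>auto intro!: in_\<Omega>\<close>)
  then have "((\<lambda>y. \<mu> (\<mu> (\<kappa>\<^sub>0 g, y), \<kappa>\<^sub>0 (inv g))) has_derivative
      (\<lambda>h. d\<mu> (\<kappa>\<^sub>0 g, \<kappa>\<^sub>0 (inv g)) (d\<mu> (\<kappa>\<^sub>0 g, \<o>) (0, h), 0))) (at \<o>)"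
    by (simp add: g)
  then have "(conj_chart g has_derivative (\<lambda>h. d\<mu> (\<kappa>\<^sub>0 g, \<kappa>\<^sub>0 (inv g)) (d\<mu> (\<kappa>\<^sub>0 g, \<o>) (0, h), 0))) (at \<o>)"
  proof (rule has_derivative_transform_eventually)
    have "((\<lambda>y. g \<otimes> \<phi> y) \<longlongrightarrow> g \<otimes> \<one>) (at \<o>)"
      by (intro tendsto_intros \<phi>_tendsto_one)
    then have "\<forall>\<^sub>F y in at \<o>. g \<otimes> \<phi> y \<in> U\<^sub>0"
      using assms chart0(1) by (auto dest: topological_tendstoD)
    then show "\<forall>\<^sub>F y in at \<o>. \<mu> (\<mu> (\<kappa>\<^sub>0 g, y), \<kappa>\<^sub>0 (inv g)) = conj_chart g y"
      by eventually_elim (simp add: local_mult_def conj_chart_def chart0 assms)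
    show "\<mu> (\<mu> (\<kappa>\<^sub>0 g, \<o>), \<kappa>\<^sub>0 (inv g)) = conj_chart g \<o>"
      using assms by (simp add: g \<mu>_chart)
  qed auto
  then show ?thesis using Ad_has_derivative has_derivative_unique by metis
qed

lemma continuous_on_Ad_one: "continuous_on (U\<^sub>0 \<inter> {g. inv g \<in> U\<^sub>0}) (\<lambda>g. Ad g w)"
proof -
  let ?N = "U\<^sub>0 \<inter> {g. inv g \<in> U\<^sub>0}"
  have k: "continuous_on ?N \<kappa>\<^sub>0" using chart0(3) continuous_on_subset by blast
  have ki: "continuous_on ?N (\<lambda>g. \<kappa>\<^sub>0 (inv g))"
    by (rule continuous_on_compose2[OF chart0(3)]) (auto intro!: continuous_intros)
  have 1: "continuous_on ?N (\<lambda>g. d\<mu> (\<kappa>\<^sub>0 g, \<o>) (0, w))"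
    by (rule continuous_on_frechet_derivative[OF Ck_\<mu>]) (auto intro!: continuous_intros k in_\<Omega>_origin)
  have "continuous_on ?N (\<lambda>g. d\<mu> (\<kappa>\<^sub>0 g, \<kappa>\<^sub>0 (inv g)) (d\<mu> (\<kappa>\<^sub>0 g, \<o>) (0, w), 0))"
    by (rule continuous_on_frechet_derivative[OF Ck_\<mu>])
      (use chart_at_one in \<open>auto intro!: continuous_intros k ki 1 in_\<Omega>\<close>)
  then show ?thesis by (rule continuous_on_eq) (simp add: Ad_in_chart)
qed

lemma open_inv_U\<^sub>0: "open (U\<^sub>0 \<inter> {g. inv g \<in> U\<^sub>0})"
proof -
  have "open ((\<lambda>g. inv g) -` U\<^sub>0)"
    by (rule open_vimage[OF chart0(1)]) (intro continuous_intros)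
  then show ?thesis using chart0(1) by (simp add: vimage_def open_Int)
qed

text \<open>Continuity at the identity is transported to \<open>g\<close> by
  \<open>Ad h = Ad g \<circ> Ad (inv g \<otimes> h)\<close>.\<close>

lemma isCont_Ad: "isCont (\<lambda>g. Ad g w) g"
proof -
  have "isCont (\<lambda>g. Ad g w) \<one>"
    using continuous_on_Ad_one open_inv_U\<^sub>0 chart_at_one by (simp add: continuous_on_eq_continuous_at)
  moreover have "((\<lambda>h. inv g \<otimes> h) \<longlongrightarrow> inv g \<otimes> g) (at g)"
    by (intro tendsto_intros)
  ultimately have "((\<lambda>h. Ad (inv g \<otimes> h) w) \<longlongrightarrow> Ad \<one> w) (at g)"
    by (intro isCont_tendsto_compose[of \<one> "\<lambda>h. Ad h w"]) auto
  then have "((\<lambda>h. Ad g (Ad (inv g \<otimes> h) w)) \<longlongrightarrow> Ad g (Ad \<one> w)) (at g)"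
    by (rule bounded_linear.tendsto[OF linear_conv_bounded_linear[THEN iffD1, OF linear_Ad]])
  then show ?thesis by (simp add: isCont_def Ad_mult)
qed

lemma continuous_on_Ad [continuous_intros]:
  assumes "continuous_on S f"
  shows "continuous_on S (\<lambda>x. Ad (f x) w)"
  using continuous_on_compose2[of UNIV "\<lambda>g. Ad g w" S f] isCont_Ad assms
  by (simp add: continuous_on_eq_continuous_at)

lemma \<kappa>\<^sub>0_has_derivative_at_one:
  fixes f :: "'a::real_normed_vector \<Rightarrow> 'g"
  assumes "has_log_derivative f L x" "f x = \<one>"
  shows "((\<lambda>y. \<kappa>\<^sub>0 (f y)) has_derivative L) (at x)"
  using assms by (simp add: has_log_derivative_def)

text \<open>In the formula of \<open>Ad_in_chart\<close> the inner factor contributes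
  \<open>d2\<mu> (0, w) (X, 0)\<close>. The outer one contributes
  \<open>- d2\<mu> (0, X) (w, 0)\<close>: the sign comes from the velocity of the inverse, and the
  pure second derivative vanishes. The sum is the bracket.\<close>

lemma Ad_curve_derivative:
  assumes "has_log_derivative \<gamma> (\<lambda>h. h *\<^sub>R X) 0" "\<gamma> 0 = \<one>"
  shows "((\<lambda>t. Ad (\<gamma> t) w) has_vector_derivative lie_bracket X w) (at (0::real))"
proof -
  define x where "x t = \<kappa>\<^sub>0 (\<gamma> t)" for t
  define z where "z t = \<kappa>\<^sub>0 (inv (\<gamma> t))" for t
  have x0: "x 0 = \<o>" "z 0 = \<o>" using assms(2) by (auto simp: x_def z_def)
  have dx: "(x has_derivative (\<lambda>h. h *\<^sub>R X)) (at 0)"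
    unfolding x_def[abs_def] by (rule \<kappa>\<^sub>0_has_derivative_at_one[OF assms])
  have dz: "(z has_derivative (\<lambda>h. - (h *\<^sub>R X))) (at 0)"
    unfolding z_def[abs_def]
    using \<kappa>\<^sub>0_has_derivative_at_one[OF has_log_derivative_inv[OF assms(1)]] assms(2) by simp
  define u where "u t = d\<mu> (x t, \<o>) (0, w)" for t
  have u0: "u 0 = w" by (simp add: u_def x0 d\<mu>_origin)
  have du: "(u has_derivative (\<lambda>h. d2\<mu> (0, w) (h *\<^sub>R X, 0))) (at 0)"
    unfolding u_def[abs_def]
    by (rule has_derivative_compose[where f = "\<lambda>t. (x t, \<o>)"])
      (auto simp: x0 intro!: derivative_eq_intros dx d2\<mu>_has_derivative)
  have db: "((\<lambda>t. d\<mu> (x t, z t) (b, 0)) has_derivative (\<lambda>h. d2\<mu> (b, 0) (h *\<^sub>R X, - (h *\<^sub>R X)))) (at 0)" for b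
    by (rule has_derivative_compose[where f = "\<lambda>t. (x t, z t)"])
      (auto simp: x0 intro!: derivative_eq_intros dx dz d2\<mu>_has_derivative)
  \<comment> \<open>Base point and direction of the outer derivative both move with
    \<open>t\<close>; after expanding the direction \<open>u t\<close> in the basis, the product
    rule handles them separately.\<close>
  have "((\<lambda>t. \<Sum>b\<in>Basis. (u t \<bullet> b) *\<^sub>R d\<mu> (x t, z t) (b, 0)) has_derivative
      (\<lambda>h. \<Sum>b\<in>Basis. (u 0 \<bullet> b) *\<^sub>R d2\<mu> (b, 0) (h *\<^sub>R X, - (h *\<^sub>R X)) +
        (d2\<mu> (0, w) (h *\<^sub>R X, 0) \<bullet> b) *\<^sub>R d\<mu> (x 0, z 0) (b, 0))) (at 0)"
    by (intro has_derivative_sum has_derivative_scaleR has_derivative_inner_left du db)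
  also have "(\<lambda>h. \<Sum>b\<in>Basis. (u 0 \<bullet> b) *\<^sub>R d2\<mu> (b, 0) (h *\<^sub>R X, - (h *\<^sub>R X)) +
        (d2\<mu> (0, w) (h *\<^sub>R X, 0) \<bullet> b) *\<^sub>R d\<mu> (x 0, z 0) (b, 0)) = (\<lambda>h. h *\<^sub>R lie_bracket X w)"
  proof
    fix h
    have comb: "(\<Sum>b\<in>Basis. (w \<bullet> b) *\<^sub>R (b, 0::'e)) = (w, 0)"
      by (simp add: prod_eq_iff fst_sum snd_sum euclidean_representation)
    \<comment> \<open>Symmetry puts the basis vectors into the argument in which linearity is known,
      so that the expansion of \<open>w\<close> can be summed up again.\<close>
    have "(\<Sum>b\<in>Basis. (w \<bullet> b) *\<^sub>R d2\<mu> (b, 0) (h *\<^sub>R X, - (h *\<^sub>R X))) =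
        (\<Sum>b\<in>Basis. (w \<bullet> b) *\<^sub>R d2\<mu> (h *\<^sub>R X, - (h *\<^sub>R X)) (b, 0))"
      by (simp add: d2\<mu>_symmetric[of "(_, 0)"])
    also have "\<dots> = d2\<mu> (h *\<^sub>R X, - (h *\<^sub>R X)) (\<Sum>b\<in>Basis. (w \<bullet> b) *\<^sub>R (b, 0))"
      by (simp only: linear_sum[OF linear_d2\<mu>] linear_scale[OF linear_d2\<mu>])
    also have "\<dots> = d2\<mu> (w, 0) (h *\<^sub>R X, - (h *\<^sub>R X))"
      unfolding comb by (rule d2\<mu>_symmetric)
    also have "\<dots> = d2\<mu> (w, 0) (h *\<^sub>R (X, 0) - h *\<^sub>R (0, X))" by simp
    also have "\<dots> = h *\<^sub>R d2\<mu> (w, 0) (X, 0) - h *\<^sub>R d2\<mu> (w, 0) (0, X)"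
      by (simp only: linear_diff[OF linear_d2\<mu>] linear_scale[OF linear_d2\<mu>])
    also have "\<dots> = - (h *\<^sub>R d2\<mu> (0, X) (w, 0))"
      by (simp add: d2\<mu>_left d2\<mu>_symmetric[of "(w, 0)"])
    finally have 1: "(\<Sum>b\<in>Basis. (w \<bullet> b) *\<^sub>R d2\<mu> (b, 0) (h *\<^sub>R X, - (h *\<^sub>R X))) = - (h *\<^sub>R d2\<mu> (0, X) (w, 0))" .
    have 2: "d2\<mu> (0, w) (h *\<^sub>R X, 0) = h *\<^sub>R d2\<mu> (0, w) (X, 0)"
      using linear_scale[OF linear_d2\<mu>, of "(0, w)" h "(X, 0)"] by simp
    show "(\<Sum>b\<in>Basis. (u 0 \<bullet> b) *\<^sub>R d2\<mu> (b, 0) (h *\<^sub>R X, - (h *\<^sub>R X)) +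
        (d2\<mu> (0, w) (h *\<^sub>R X, 0) \<bullet> b) *\<^sub>R d\<mu> (x 0, z 0) (b, 0)) = h *\<^sub>R lie_bracket X w"
      by (simp add: sum.distrib u0 x0 d\<mu>_origin 1 euclidean_representation)
        (simp add: 2 lie_bracket_eq algebra_simps)
  qed
  finally have "((\<lambda>t. \<Sum>b\<in>Basis. (u t \<bullet> b) *\<^sub>R d\<mu> (x t, z t) (b, 0)) has_derivative (\<lambda>h. h *\<^sub>R lie_bracket X w)) (at 0)" .
  then have "((\<lambda>t. Ad (\<gamma> t) w) has_derivative (\<lambda>h. h *\<^sub>R lie_bracket X w)) (at 0)"
  proof (rule has_derivative_transform_eventually)
    have eq: "(\<Sum>b\<in>Basis. (u t \<bullet> b) *\<^sub>R d\<mu> (x t, z t) (b, 0)) = Ad (\<gamma> t) w"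
      if t: "\<gamma> t \<in> U\<^sub>0 \<inter> {g. inv g \<in> U\<^sub>0}" for t
    proof -
      have "(x t, z t) \<in> \<Omega>" unfolding x_def z_def using t chart_at_one by (auto intro!: in_\<Omega>)
      note lin = linear_d\<mu>[OF this]
      have comb: "(\<Sum>b\<in>Basis. (u t \<bullet> b) *\<^sub>R (b, 0::'e)) = (u t, 0)"
        by (simp add: prod_eq_iff fst_sum snd_sum euclidean_representation)
      have "(\<Sum>b\<in>Basis. (u t \<bullet> b) *\<^sub>R d\<mu> (x t, z t) (b, 0)) =
          d\<mu> (x t, z t) (\<Sum>b\<in>Basis. (u t \<bullet> b) *\<^sub>R (b, 0))"
        by (simp only: linear_sum[OF lin] linear_scale[OF lin])
      then show ?thesis unfolding comb using Ad_in_chart[of "\<gamma> t" w] t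
        by (simp add: x_def z_def u_def)
    qed
    have "isCont \<gamma> 0" using assms(1) by (simp add: has_log_derivative_def)
    then have "\<forall>\<^sub>F t in at 0. \<gamma> t \<in> U\<^sub>0 \<inter> {g. inv g \<in> U\<^sub>0}"
      using open_inv_U\<^sub>0 chart_at_one assms(2) by (intro isCont_eventually_in_open) auto
    then show "\<forall>\<^sub>F t in at 0. (\<Sum>b\<in>Basis. (u t \<bullet> b) *\<^sub>R d\<mu> (x t, z t) (b, 0)) = Ad (\<gamma> t) w"
      by eventually_elim (rule eq)
    show "(\<Sum>b\<in>Basis. (u 0 \<bullet> b) *\<^sub>R d\<mu> (x 0, z 0) (b, 0)) = Ad (\<gamma> 0) w"
      by (rule eq) (use assms(2) chart_at_one in auto)
  qed auto
  then show ?thesis by (simp add: has_vector_derivative_def)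
qed

section \<open>Uniqueness and existence of integral curves\<close>

lemma has_log_derivative_transform:
  fixes f :: "'a::real_normed_vector \<Rightarrow> 'g"
  assumes "has_log_derivative f L x" "open S" "x \<in> S" "\<And>y. y \<in> S \<Longrightarrow> f y = g y"
  shows "has_log_derivative g L x"
proof -
  have "\<forall>\<^sub>F y in nhds x. f y = g y"
    using eventually_nhds_in_open[OF assms(2,3)] by eventually_elim (rule assms(4))
  then have "isCont f x \<longleftrightarrow> isCont g x" by (rule isCont_cong)
  moreover have "((\<lambda>y. \<kappa>\<^sub>0 (inv (f x) \<otimes> g y)) has_derivative L) (at x)"
    by (rule has_derivative_transform_within_open[OF _ assms(2,3), where f = "\<lambda>y. \<kappa>\<^sub>0 (inv (f x) \<otimes> f y)"])
      (use assms(1,4) in \<open>auto simp: has_log_derivative_def\<close>)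
  moreover have "f x = g x" using assms(3,4) by blast
  ultimately show ?thesis using assms(1) by (simp add: has_log_derivative_def)
qed

lemma has_log_derivative_compose:
  fixes f :: "'a::real_normed_vector \<Rightarrow> 'g"
  assumes "(k has_derivative k') (at x)" "has_log_derivative f L (k x)"
  shows "has_log_derivative (\<lambda>y. f (k y)) (\<lambda>h. L (k' h)) x"
proof -
  have "((\<lambda>y. \<kappa>\<^sub>0 (inv (f (k x)) \<otimes> f (k y))) has_derivative (\<lambda>h. L (k' h))) (at x)"
    by (rule has_derivative_compose[OF assms(1)]) (use assms(2) in \<open>simp add: has_log_derivative_def\<close>)
  moreover have "isCont (\<lambda>y. f (k y)) x"
    by (rule isCont_o2[OF has_derivative_continuous[OF assms(1)]])
      (use assms(2) in \<open>simp add: has_log_derivative_def\<close>)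
  ultimately show ?thesis by (simp add: has_log_derivative_def)
qed

lemma has_log_derivative_left_mult:
  fixes f :: "'a::real_normed_vector \<Rightarrow> 'g"
  assumes "has_log_derivative f L x"
  shows "has_log_derivative (\<lambda>y. a \<otimes> f y) L x"
  using assms unfolding has_log_derivative_def
  by (auto intro!: continuous_intros simp: inv_mult_group m_assoc)

text \<open>Near \<open>x\<close> the translate \<open>inv (f x) \<otimes> f y\<close> stays in
  \<open>U\<^sub>0\<close>, where its coordinates have zero derivative; connectedness passes from
  locally to globally constant.\<close>

lemma zero_log_derivative_constant:
  fixes f :: "'a::real_normed_vector \<Rightarrow> 'g"
  assumes "open S" "connected S" "\<And>x. x \<in> S \<Longrightarrow> has_log_derivative f (\<lambda>h. 0) x" "a \<in> S" "b \<in> S"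
  shows "f a = f b"
proof (rule connected_local_const[OF assms(2,4,5)], rule ballI)
  fix x assume x: "x \<in> S"
  have cont: "isCont (\<lambda>y. inv (f x) \<otimes> f y) y" if "y \<in> S" for y
    using assms(3)[OF that] unfolding has_log_derivative_def by (auto intro!: continuous_intros)
  have "\<forall>\<^sub>F y in nhds x. inv (f x) \<otimes> f y \<in> U\<^sub>0"
    using cont[OF x] chart0(1) chart_at_one topological_tendstoD
    unfolding isCont_def eventually_nhds_conv_at by auto
  moreover have "\<forall>\<^sub>F y in nhds x. y \<in> S" using assms(1) x by (rule eventually_nhds_in_open)
  ultimately have "\<forall>\<^sub>F y in nhds x. y \<in> S \<and> inv (f x) \<otimes> f y \<in> U\<^sub>0" by eventually_elim simp
  then obtain d where d: "d > 0" "\<And>y. dist y x < d \<Longrightarrow> y \<in> S \<and> inv (f x) \<otimes> f y \<in> U\<^sub>0"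
    unfolding eventually_nhds_metric by auto
  have "\<exists>c. \<forall>y\<in>ball x d. \<kappa>\<^sub>0 (inv (f x) \<otimes> f y) = c"
  proof (rule has_derivative_zero_constant[OF convex_ball])
    fix y assume "y \<in> ball x d"
    then have y: "y \<in> S" "inv (f x) \<otimes> f y \<in> U\<^sub>0" using d(2) by (auto simp: dist_commute)
    have "((\<lambda>y. \<kappa>\<^sub>0 (inv (f x) \<otimes> f y)) has_derivative (\<lambda>h. left_inv_field \<kappa>\<^sub>0 0 (inv (f x) \<otimes> f y))) (at y)"
      by (rule has_log_derivative_in_chart[OF chart_at_one(1) y(2) has_log_derivative_left_mult[OF assms(3)[OF y(1)]]])
    then show "((\<lambda>y. \<kappa>\<^sub>0 (inv (f x) \<otimes> f y)) has_derivative (\<lambda>h. 0)) (at y within ball x d)"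
      using linear_0[OF linear_left_inv_field[OF chart_at_one(1) y(2)]]
      by (auto intro: has_derivative_at_withinI)
  qed
  then obtain c where c: "\<And>y. y \<in> ball x d \<Longrightarrow> \<kappa>\<^sub>0 (inv (f x) \<otimes> f y) = c" by blast
  have "f y = f x" if "y \<in> ball x d" for y
  proof -
    have "\<kappa>\<^sub>0 (inv (f x) \<otimes> f y) = \<kappa>\<^sub>0 (inv (f x) \<otimes> f x)" using c[OF that] c[of x] d(1) by (metis centre_in_ball)
    then have "inv (f x) \<otimes> f y = inv (f x) \<otimes> f x"
      using chart0(5)[of "inv (f x) \<otimes> f y"] d(2)[of y] that chart_at_one
      by (metis \<phi>_origin dist_commute in_carrier l_inv mem_ball)
    then show ?thesis by (metis inv_mult_cancel(2))
  qed
  then have "\<forall>\<^sub>F y in nhds x. f x = f y"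
    unfolding eventually_nhds_metric using d(1) by (metis dist_commute mem_ball)
  then show "\<forall>\<^sub>F y in at x within S. f x = f y"
    unfolding eventually_at_filter by (rule eventually_mono) blast
qed

text \<open>In the quotient \<open>f y \<otimes> inv (g y)\<close> the two contributions
  \<open>Ad (g x) (L x h)\<close> cancel.\<close>

lemma log_derivative_unique:
  fixes f g :: "'a::real_normed_vector \<Rightarrow> 'g"
  assumes "open S" "connected S" "a \<in> S" "f a = g a"
    and "\<And>x. x \<in> S \<Longrightarrow> has_log_derivative f (L x) x"
    and "\<And>x. x \<in> S \<Longrightarrow> has_log_derivative g (L x) x"
    and "x \<in> S"
  shows "f x = g x"
proof -
  have "has_log_derivative (\<lambda>y. f y \<otimes> inv (g y)) (\<lambda>h. 0) x" if "x \<in> S" for x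
    using has_log_derivative_mult[OF assms(5)[OF that] has_log_derivative_inv[OF assms(6)[OF that]]] by simp
  from zero_log_derivative_constant[OF assms(1,2) this assms(7,3)]
  have "f x \<otimes> inv (g x) = \<one>" using assms(4) by simp
  then show ?thesis by (metis in_carrier inv_equality inv_inv inv_closed)
qed

lemma integral_curve_iff:
  "integral_curve_from_one v \<gamma> \<longleftrightarrow> \<gamma> 0 = \<one> \<and> (\<forall>t. has_log_derivative \<gamma> (\<lambda>h. h *\<^sub>R v) t)"
proof safe
  assume *: "integral_curve_from_one v \<gamma>"
  then show "\<gamma> 0 = \<one>" by (simp add: integral_curve_from_one_def)
  fix t
  obtain U \<psi> where c: "(U, \<psi>) \<in> A" "\<gamma> t \<in> U" by (rule chart_at)
  have "((\<lambda>s. \<psi> (\<gamma> s)) has_derivative (\<lambda>h. h *\<^sub>R left_inv_field \<psi> v (\<gamma> t))) (at t)" and "isCont \<gamma> t"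
    using * c unfolding integral_curve_from_one_def has_vector_derivative_def
    by (auto simp: continuous_on_eq_continuous_at)
  then show "has_log_derivative \<gamma> (\<lambda>h. h *\<^sub>R v) t"
    by (intro has_log_derivative_from_chart[where f = \<gamma> and x = t, OF c]) (simp_all add: linear_scale[OF linear_left_inv_field[OF c]])
next
  assume *: "\<gamma> 0 = \<one>" "\<forall>t. has_log_derivative \<gamma> (\<lambda>h. h *\<^sub>R v) t"
  have "((\<lambda>s. \<psi> (\<gamma> s)) has_vector_derivative left_inv_field \<psi> v (\<gamma> t)) (at t)"
    if "(U, \<psi>) \<in> A" "\<gamma> t \<in> U" for t U \<psi>
    using has_log_derivative_in_chart[where f = \<gamma> and x = t and L = "\<lambda>h. h *\<^sub>R v", OF that] * linear_scale[OF linear_left_inv_field[OF that]]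
    by (simp add: has_vector_derivative_def)
  then show "integral_curve_from_one v \<gamma>"
    using * unfolding integral_curve_from_one_def
    by (auto simp: has_log_derivative_def continuous_on_eq_continuous_at)
qed

lemma integral_curve_unique:
  assumes "integral_curve_from_one v \<gamma>" "integral_curve_from_one v \<eta>"
  shows "\<gamma> = \<eta>"
proof
  fix t show "\<gamma> t = \<eta> t"
    by (rule log_derivative_unique[where S = UNIV and a = 0 and L = "\<lambda>_ h. h *\<^sub>R v"])
      (use assms in \<open>auto simp: integral_curve_iff\<close>)
qed

text \<open>In the chart the left-invariant field is
  \<open>x \<mapsto> d\<mu> (x, \<o>) (0, v)\<close>; it is continuously differentiable as a partial
  derivative of the smooth \<open>\<mu>\<close>, hence locally Lipschitz.\<close>

lemma integral_curve_local:
  obtains h \<gamma> where "h > 0" "\<gamma> 0 = \<one>" "\<And>t. \<bar>t\<bar> < h \<Longrightarrow> has_log_derivative \<gamma> (\<lambda>d. d *\<^sub>R v) t"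
proof -
  define f where "f x = d\<mu> (x, \<o>) (0, v)" for x
  have df: "(f has_derivative (\<lambda>h. frechet_derivative (\<lambda>p. d\<mu> p (0, v)) (at (x, \<o>)) (h, 0))) (at x)"
    if "x \<in> \<kappa>\<^sub>0 ` U\<^sub>0" for x
    unfolding f_def[abs_def]
    by (rule has_derivative_compose[where f = "\<lambda>x. (x, \<o>)", OF _ d\<mu>_has_derivative])
      (auto intro!: derivative_eq_intros in_\<Omega>_origin that)
  have "Ck_on (Suc 0) f (\<kappa>\<^sub>0 ` U\<^sub>0)"
  proof -
    have "continuous_on (\<kappa>\<^sub>0 ` U\<^sub>0) (\<lambda>x. frechet_derivative (\<lambda>p. d\<mu> p (0, v)) (at (x, \<o>)) (k, 0))" for k
      by (rule continuous_on_frechet_derivative[OF Ck_d\<mu>])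
        (auto intro!: continuous_intros in_\<Omega>_origin)
    then have "continuous_on (\<kappa>\<^sub>0 ` U\<^sub>0) (\<lambda>x. frechet_derivative f (at x) k)" for k
      by (rule continuous_on_eq) (simp flip: frechet_derivative_at[OF df])
    moreover have "f differentiable (at x)" if "x \<in> \<kappa>\<^sub>0 ` U\<^sub>0" for x
      using df[OF that] differentiableI by blast
    ultimately show ?thesis by simp
  qed
  from locally_lipschitz[OF chart0(2) origin_in this]
  obtain r L where r: "r > 0" "L > 0" "cball \<o> r \<subseteq> \<kappa>\<^sub>0 ` U\<^sub>0"
    "\<And>x y. x \<in> cball \<o> r \<Longrightarrow> y \<in> cball \<o> r \<Longrightarrow> norm (f x - f y) \<le> L * norm (x - y)"
    by blast
  from picard_lindelof[OF r(1,2), of \<o> f] r(4)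
  obtain h x where x: "h > 0" "x 0 = \<o>"
    "\<And>t. \<bar>t\<bar> < h \<Longrightarrow> x t \<in> cball \<o> r \<and> (x has_vector_derivative f (x t)) (at t)" by metis
  have "has_log_derivative (\<lambda>t. \<phi> (x t)) (\<lambda>d. d *\<^sub>R v) t" if t: "\<bar>t\<bar> < h" for t
  proof -
    have in_dom: "x s \<in> \<kappa>\<^sub>0 ` U\<^sub>0" if "\<bar>s\<bar> < h" for s using x(3)[OF that] r(3) by blast
    note xt = chart_inv_into[OF chart_at_one(1) in_dom[OF t]]
    have d: "(x has_derivative (\<lambda>d. d *\<^sub>R f (x t))) (at t)"
      using x(3)[OF t] by (simp add: has_vector_derivative_def)
    show ?thesis
    proof (rule has_log_derivative_from_chart[where f = "\<lambda>t. \<phi> (x t)" and x = t, OF chart_at_one(1) xt(1)])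
      show "isCont (\<lambda>t. \<phi> (x t)) t"
        using isCont_o2[OF has_derivative_continuous[OF d]] chart0(2,4) in_dom[OF t]
          continuous_on_eq_continuous_at by blast
      have "left_inv_field \<kappa>\<^sub>0 (d *\<^sub>R v) (\<phi> (x t)) = d *\<^sub>R f (x t)" for d
        using linear_scale[OF linear_left_inv_field[OF chart_at_one(1) xt(1)]] xt
        by (simp add: left_inv_field_\<kappa>\<^sub>0 f_def)
      then have "(x has_derivative (\<lambda>d. left_inv_field \<kappa>\<^sub>0 (d *\<^sub>R v) (\<phi> (x t)))) (at t)"
        using d by simp
      then show "((\<lambda>t. \<kappa>\<^sub>0 (\<phi> (x t))) has_derivative (\<lambda>d. left_inv_field \<kappa>\<^sub>0 (d *\<^sub>R v) (\<phi> (x t)))) (at t)"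
      proof (rule has_derivative_transform_within_open)
        show "open {-h<..<h}" "t \<in> {-h<..<h}" using t by auto
        show "x s = \<kappa>\<^sub>0 (\<phi> (x s))" if "s \<in> {-h<..<h}" for s
          using chart_inv_into(2)[OF chart_at_one(1) in_dom[of s]] that by (simp add: abs_less_iff)
      qed
    qed
  qed
  then show ?thesis using that[of h "\<lambda>t. \<phi> (x t)"] x by simp
qed

text \<open>Left translates of an integral curve are integral curves, so a short piece is continued
  indefinitely by multiplying it with powers of its value at time \<open>h\<close>.\<close>

lemma integral_curve_exists: "\<exists>\<gamma>. integral_curve_from_one v \<gamma>"
proof -
  obtain h\<^sub>0 \<gamma> where \<gamma>: "h\<^sub>0 > 0" "\<gamma> 0 = \<one>" "\<And>t. \<bar>t\<bar> < h\<^sub>0 \<Longrightarrow> has_log_derivative \<gamma> (\<lambda>d. d *\<^sub>R v) t"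
    using integral_curve_local[of v] by blast
  \<comment> \<open>Halving keeps \<open>h + s\<close> inside the domain of the local solution for
    all \<open>s\<close> between \<open>-h\<close> and \<open>h\<close>.\<close>
  define h where "h = h\<^sub>0 / 2"
  have h: "h > 0" "h\<^sub>0 = 2 * h" using \<gamma>(1) by (auto simp: h_def)
  define a where "a = \<gamma> h"
  have shift: "\<gamma> (h + s) = a \<otimes> \<gamma> s" if "\<bar>s\<bar> < h" for s
  proof (rule log_derivative_unique[where S = "{-h<..<h}" and a = 0 and L = "\<lambda>_ d. d *\<^sub>R v"])
    show "has_log_derivative (\<lambda>s. a \<otimes> \<gamma> s) (\<lambda>d. d *\<^sub>R v) x" if "x \<in> {-h<..<h}" for x
      using that h by (intro has_log_derivative_left_mult \<gamma>(3)) auto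
    show "has_log_derivative (\<lambda>s. \<gamma> (h + s)) (\<lambda>d. d *\<^sub>R v) x" if "x \<in> {-h<..<h}" for x
      by (rule has_log_derivative_compose[where k' = "\<lambda>d. d"])
        (use that h in \<open>auto intro!: derivative_eq_intros \<gamma>(3)\<close>)
  qed (use h that \<gamma>(2) in \<open>auto simp: a_def\<close>)
  define \<Gamma> where "\<Gamma> t = a [^] \<lfloor>t / h\<rfloor> \<otimes> \<gamma> (t - of_int \<lfloor>t / h\<rfloor> * h)" for t
  \<comment> \<open>The formula for the piece starting at \<open>of_int k * h\<close> also holds on
    the piece before it. It is thus valid on an open interval around the gluing point, and can be
    differentiated there.\<close>
  have \<Gamma>_eq: "\<Gamma> s = a [^] k \<otimes> \<gamma> (s - of_int k * h)"
    if "s \<in> {of_int k * h - h<..<of_int k * h + h}" for s k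
  proof (cases "s \<ge> of_int k * h")
    case True
    have "\<lfloor>s / h\<rfloor> = k" by (rule floor_unique) (use True that h(1) in \<open>auto simp: field_simps\<close>)
    then show ?thesis by (simp add: \<Gamma>_def)
  next
    case False
    have k: "\<lfloor>s / h\<rfloor> = k - 1" by (rule floor_unique) (use False that h(1) in \<open>auto simp: field_simps\<close>)
    have "s - of_int (k - 1) * h = h + (s - of_int k * h)" by (simp add: algebra_simps)
    then have "\<Gamma> s = a [^] (k - 1) \<otimes> \<gamma> (h + (s - of_int k * h))" unfolding \<Gamma>_def k by (simp only:)
    also have "\<gamma> (h + (s - of_int k * h)) = a \<otimes> \<gamma> (s - of_int k * h)"
      by (rule shift) (use that False in auto)
    also have "a [^] (k - 1) \<otimes> (a \<otimes> \<gamma> (s - of_int k * h)) = a [^] k \<otimes> \<gamma> (s - of_int k * h)"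
      using int_pow_mult[of a "k - 1" 1] m_assoc[of "a [^] (k - 1)" a] by simp
    finally show ?thesis .
  qed
  have "has_log_derivative \<Gamma> (\<lambda>d. d *\<^sub>R v) t" for t
  proof -
    define k where "k = \<lfloor>t / h\<rfloor>"
    have k: "of_int k * h \<le> t" "t < of_int k * h + h"
      using h floor_divide_lower[OF h(1), of t] floor_divide_upper[OF h(1), of t]
      by (auto simp: k_def algebra_simps)
    have "has_log_derivative (\<lambda>s. a [^] k \<otimes> \<gamma> (s - of_int k * h)) (\<lambda>d. d *\<^sub>R v) t"
      by (rule has_log_derivative_left_mult, rule has_log_derivative_compose[where k' = "\<lambda>d. d"])
        (use k h in \<open>auto intro!: derivative_eq_intros \<gamma>(3)\<close>)
    then show ?thesis
      by (rule has_log_derivative_transform[where S = "{of_int k * h - h<..<of_int k * h + h}"])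
        (use k h \<Gamma>_eq in auto)
  qed
  moreover have "\<Gamma> 0 = \<one>" by (simp add: \<Gamma>_def \<gamma>(2))
  ultimately show ?thesis using integral_curve_iff by blast
qed

lemma lie_exp_eq: "integral_curve_from_one v \<gamma> \<Longrightarrow> lie_exp v = \<gamma> 1"
  unfolding lie_exp_def using integral_curve_unique by (metis the_equality)

lemma integral_curve_scale:
  assumes "integral_curve_from_one v \<gamma>"
  shows "integral_curve_from_one (c *\<^sub>R v) (\<lambda>t. \<gamma> (c * t))"
proof -
  have "has_log_derivative (\<lambda>t. \<gamma> (c * t)) (\<lambda>h. (c * h) *\<^sub>R v) t" for t
    by (rule has_log_derivative_compose)
      (use assms in \<open>auto simp: integral_curve_iff intro!: derivative_eq_intros\<close>)
  then show ?thesis using assms by (simp add: integral_curve_iff mult.commute)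
qed

lemma integral_curve_lie_exp: "integral_curve_from_one v (\<lambda>t. lie_exp (t *\<^sub>R v))"
proof -
  obtain \<gamma> where \<gamma>: "integral_curve_from_one v \<gamma>" using integral_curve_exists by blast
  have "lie_exp (t *\<^sub>R v) = \<gamma> t" for t
    using lie_exp_eq[OF integral_curve_scale[OF \<gamma>, of t]] by simp
  with \<gamma> show ?thesis by presburger
qed

lemma lie_exp_log_derivative: "has_log_derivative (\<lambda>t. lie_exp (t *\<^sub>R v)) (\<lambda>h. h *\<^sub>R v) t"
  using integral_curve_lie_exp integral_curve_iff by blast

lemma lie_exp_0 [simp]: "lie_exp 0 = \<one>"
  using integral_curve_lie_exp[of 0] by (simp add: integral_curve_iff)

lemma continuous_on_lie_exp:
  assumes "continuous_on S f"
  shows "continuous_on S (\<lambda>x. lie_exp (f x *\<^sub>R v))"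
proof -
  have "continuous_on UNIV (\<lambda>t. lie_exp (t *\<^sub>R v))"
    using integral_curve_lie_exp by (simp add: integral_curve_from_one_def)
  from continuous_on_compose2[OF this assms] show ?thesis by simp
qed

end

section \<open>The semigroup generated by exponentials\<close>

context lie_group_with_chart
begin

text \<open>The identity is included so that the empty word counts and \<open>W\<close> itself lies
  in its orbit under \<open>Ad\<close>.\<close>

inductive_set exp_semigroup :: "'e set \<Rightarrow> 'g set" for W where
  one: "\<one> \<in> exp_semigroup W"
| step: "X \<in> W \<Longrightarrow> t > 0 \<Longrightarrow> q \<in> exp_semigroup W \<Longrightarrow> lie_exp (t *\<^sub>R X) \<otimes> q \<in> exp_semigroup W"

lemma exp_semigroup_mult:
  assumes "p \<in> exp_semigroup W" "q \<in> exp_semigroup W"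
  shows "p \<otimes> q \<in> exp_semigroup W"
  using assms by (induction) (auto simp: m_assoc intro: exp_semigroup.step)

lemma exp_semigroup_exp: "X \<in> W \<Longrightarrow> t > 0 \<Longrightarrow> lie_exp (t *\<^sub>R X) \<in> exp_semigroup W"
  using exp_semigroup.step[OF _ _ exp_semigroup.one] by simp

primrec exp_prod :: "('e \<times> real) list \<Rightarrow> 'g" where
  "exp_prod [] = \<one>"
| "exp_prod (u # us) = lie_exp (snd u *\<^sub>R fst u) \<otimes> exp_prod us"

text \<open>The span of \<open>exp_columns us\<close> is the range of the left logarithmic derivative of \<open>exp_prod us\<close>
  with respect to the times.\<close>

primrec exp_columns :: "('e \<times> real) list \<Rightarrow> 'e set" where
  "exp_columns [] = {}"
| "exp_columns (u # us) = insert (Ad (inv (exp_prod us)) (fst u)) (exp_columns us)"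

lemma exp_prod_append: "exp_prod (us @ vs) = exp_prod us \<otimes> exp_prod vs"
  by (induction us) (auto simp: m_assoc)

text \<open>A column depends only on the factors to its right, so extending a word on the left
  preserves the old columns.\<close>

lemma exp_columns_append: "exp_columns vs \<subseteq> exp_columns (us @ vs)"
  by (induction us) auto

abbreviation positive_words :: "'e set \<Rightarrow> ('e \<times> real) list set" where
  "positive_words W \<equiv> lists (W \<times> {0<..})"

lemma exp_semigroup_word:
  assumes "q \<in> exp_semigroup W"
  obtains us where "us \<in> positive_words W" "exp_prod us = q"
proof -
  from assms have "\<exists>us \<in> positive_words W. exp_prod us = q"
  proof induction
    case one
    show ?case by (rule bexI[of _ "[]"]) auto
  next
    case (step X t q)
    then obtain us where "us \<in> positive_words W" "exp_prod us = q" by blast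
    then show ?case using step by (intro bexI[of _ "(X, t) # us"]) auto
  qed
  then show ?thesis using that by blast
qed

lemma Ad_span: "Ad g ` span S = span (Ad g ` S)"
  using linear_span_image[OF linear_Ad] by simp

section \<open>The orbit under the adjoint action and words of full rank\<close>

definition Ad_orbit_span :: "'e set \<Rightarrow> 'e set" where
  "Ad_orbit_span W = span {Ad (inv q) X |q X. q \<in> exp_semigroup W \<and> X \<in> W}"

lemma Ad_orbit_span_superset: "W \<subseteq> Ad_orbit_span W"
proof
  fix X assume "X \<in> W"
  then have "Ad (inv \<one>) X \<in> Ad_orbit_span W"
    unfolding Ad_orbit_span_def using exp_semigroup.one by (intro span_base) blast
  then show "X \<in> Ad_orbit_span W" by (simp only: inv_one Ad_one)
qed

lemma Ad_orbit_span_invariant: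
  assumes "q \<in> exp_semigroup W" "Y \<in> Ad_orbit_span W"
  shows "Ad (inv q) Y \<in> Ad_orbit_span W"
proof -
  let ?S = "{Ad (inv q) X |q X. q \<in> exp_semigroup W \<and> X \<in> W}"
  have "Ad (inv q) ` ?S \<subseteq> ?S"
  proof clarify
    fix p X assume "p \<in> exp_semigroup W" "X \<in> W"
    then show "\<exists>r Z. Ad (inv q) (Ad (inv p) X) = Ad (inv r) Z \<and> r \<in> exp_semigroup W \<and> Z \<in> W"
      using exp_semigroup_mult[OF _ assms(1), of p]
      by (intro exI[of _ "p \<otimes> q"] exI[of _ X]) (simp add: Ad_mult inv_mult_group)
  qed
  then have "Ad (inv q) ` span ?S \<subseteq> span ?S" unfolding Ad_span by (rule span_mono)
  then show ?thesis using assms(2) unfolding Ad_orbit_span_def by blast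
qed

lemma Ad_orbit_span_bracket:
  assumes "X \<in> W" "Y \<in> Ad_orbit_span W"
  shows "lie_bracket X Y \<in> Ad_orbit_span W"
proof -
  let ?D = "Ad_orbit_span W"
  have D: "subspace ?D" by (simp add: Ad_orbit_span_def)
  \<comment> \<open>The span is invariant under \<open>Ad (inv q)\<close>, hence the curve of
    inverses; its velocity is \<open>- X\<close>, and the sign is removed at the end.\<close>
  define \<gamma> where "\<gamma> t = inv (lie_exp (t *\<^sub>R X))" for t
  have "has_log_derivative \<gamma> (\<lambda>h. h *\<^sub>R (- X)) 0"
    unfolding \<gamma>_def[abs_def] using has_log_derivative_inv[OF lie_exp_log_derivative[of X 0]] by simp
  from Ad_curve_derivative[OF this, of Y]
  have "((\<lambda>t. Ad (\<gamma> t) Y) has_vector_derivative lie_bracket (- X) Y) (at 0)" by (simp add: \<gamma>_def)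
  then have lim: "((\<lambda>t. norm (Ad (\<gamma> (0 + t)) Y - Ad (\<gamma> 0) Y - t *\<^sub>R lie_bracket (- X) Y) / norm t) \<longlongrightarrow> 0) (at 0)"
    unfolding has_vector_derivative_def has_derivative_at by blast
  have "((\<lambda>t. norm ((Ad (\<gamma> t) Y - Y) /\<^sub>R t - lie_bracket (- X) Y)) \<longlongrightarrow> 0) (at 0)"
  proof (rule Lim_transform_eventually[OF lim])
    have quot: "norm (a - t *\<^sub>R b) / norm t = norm (a /\<^sub>R t - b)" if "t \<noteq> 0" for a b :: 'e and t :: real
    proof -
      have "a /\<^sub>R t - b = (a - t *\<^sub>R b) /\<^sub>R t" using that by (simp add: scaleR_right_diff_distrib)
      moreover have "norm \<dots> = norm (a - t *\<^sub>R b) / norm t" by (simp add: divide_inverse_commute)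
      ultimately show ?thesis by (simp only:)
    qed
    have \<gamma>0: "Ad (\<gamma> 0) Y = Y" by (simp add: \<gamma>_def)
    show "\<forall>\<^sub>F t in at 0. norm (Ad (\<gamma> (0 + t)) Y - Ad (\<gamma> 0) Y - t *\<^sub>R lie_bracket (- X) Y) / norm t =
        norm ((Ad (\<gamma> t) Y - Y) /\<^sub>R t - lie_bracket (- X) Y)"
      by (rule eventually_mono[OF eventually_neq_at_within[of 0]]) (unfold \<gamma>0 add_0_left, rule quot)
  qed
  then have "((\<lambda>t. (Ad (\<gamma> t) Y - Y) /\<^sub>R t) \<longlongrightarrow> lie_bracket (- X) Y) (at 0)"
    by (rule LIM_zero_cancel[OF tendsto_norm_zero_cancel])
  \<comment> \<open>The difference quotients are known to lie in the span only for
    \<open>t > 0\<close>.\<close>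
  then have "((\<lambda>t. (Ad (\<gamma> t) Y - Y) /\<^sub>R t) \<longlongrightarrow> lie_bracket (- X) Y) (at_right 0)"
    by (rule tendsto_mono[OF at_le[OF subset_UNIV]])
  moreover have "\<forall>\<^sub>F t in at_right 0. (Ad (\<gamma> t) Y - Y) /\<^sub>R t \<in> ?D"
  proof -
    have "(Ad (\<gamma> t) Y - Y) /\<^sub>R t \<in> ?D" if "t > 0" for t
      using Ad_orbit_span_invariant[OF exp_semigroup_exp[OF assms(1) that] assms(2)] assms(2) D
      by (auto simp: \<gamma>_def intro!: subspace_scale subspace_diff)
    then show ?thesis using eventually_at_right_less[of 0] by (rule eventually_mono[rotated])
  qed
  ultimately have "lie_bracket (- X) Y \<in> ?D"
    by (intro Lim_in_closed_set[OF closed_subspace[OF D] _ trivial_limit_at_right_real[of 0]])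
  then show ?thesis using subspace_neg[OF D, of "- lie_bracket X Y"] by (simp add: lie_bracket_minus_left)
qed

lemma spanning_word:
  assumes gen: "\<And>D. subspace D \<Longrightarrow> W \<subseteq> D \<Longrightarrow> (\<And>X Y. X \<in> W \<Longrightarrow> Y \<in> D \<Longrightarrow> lie_bracket X Y \<in> D) \<Longrightarrow> D = UNIV"
  obtains us where "us \<in> positive_words W" "span (exp_columns us) = UNIV"
proof -
  have D: "Ad_orbit_span W = UNIV"
    by (rule gen) (auto simp: Ad_orbit_span_bracket Ad_orbit_span_superset[THEN subsetD], simp add: Ad_orbit_span_def)
  have "\<exists>us. us \<in> positive_words W \<and> (\<forall>vs. vs \<in> positive_words W \<longrightarrow> dim (exp_columns vs) \<le> dim (exp_columns us))"
    by (rule ex_has_greatest_nat[where b = "DIM('e) + 1" and k = "[]"]) (auto simp: less_Suc_eq_le dim_subset_UNIV)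
  then obtain us where us: "us \<in> positive_words W"
    "\<And>vs. vs \<in> positive_words W \<Longrightarrow> dim (exp_columns vs) \<le> dim (exp_columns us)" by blast
  let ?p = "exp_prod us"
  have *: "Ad (inv ?p) (Ad (inv q) X) \<in> span (exp_columns us)" if q: "q \<in> exp_semigroup W" and X: "X \<in> W" for q X
  proof -
    obtain vs where vs: "vs \<in> positive_words W" "exp_prod vs = q"
      by (rule exp_semigroup_word[OF q])
    \<comment> \<open>The first column of this word is \<open>Ad (inv (q \<otimes> ?p)) X\<close>,
      the vector in question. The other columns include those of \<open>us\<close>, so maximality of
      the dimension prevents the span from growing. A column does not depend on its own time, so 1
      is as good as any positive number.\<close>
    let ?w = "(X, 1) # vs @ us"
    have w: "?w \<in> positive_words W" using vs(1) us(1) X by auto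
    have "exp_columns us \<subseteq> exp_columns ?w" using exp_columns_append[of us vs] by auto
    then have "span (exp_columns us) = span (exp_columns ?w)"
      using us(2)[OF w] by (intro dim_eq_span) auto
    moreover have "Ad (inv ?p) (Ad (inv q) X) \<in> exp_columns ?w"
      by (simp add: exp_prod_append vs(2) Ad_mult inv_mult_group)
    ultimately show ?thesis using span_base by blast
  qed
  \<comment> \<open>\<open>Ad (inv ?p)\<close> is surjective and the orbit spans everything, so its
    image does as well.\<close>
  have "Ad (inv ?p) ` Ad_orbit_span W \<subseteq> span (exp_columns us)"
    unfolding Ad_orbit_span_def Ad_span by (rule span_minimal) (use * in auto)
  moreover have "Y \<in> Ad (inv ?p) ` UNIV" for Y by (metis Ad_inv(1) rangeI)
  ultimately have "span (exp_columns us) = UNIV" unfolding D by blast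
  with us(1) that show ?thesis by blast
qed

text \<open>A triple \<open>(X, c, l)\<close> stands for the factor \<open>exp((c + l \<bullet> y)X)\<close>, with a time that depends
  affinely on the parameter \<open>y\<close>; all times are dilated by \<open>r\<close>.\<close>

primrec word_map :: "('e \<times> real \<times> 'e) list \<Rightarrow> real \<Rightarrow> 'e \<Rightarrow> 'g" where
  "word_map [] r y = \<one>"
| "word_map (w # ws) r y =
    lie_exp ((r * (fst (snd w) + snd (snd w) \<bullet> y)) *\<^sub>R fst w) \<otimes> word_map ws r y"

primrec word_deriv :: "('e \<times> real \<times> 'e) list \<Rightarrow> 'e \<Rightarrow> 'e \<Rightarrow> 'e" where
  "word_deriv [] y h = 0"
| "word_deriv (w # ws) y h =
    (snd (snd w) \<bullet> h) *\<^sub>R Ad (inv (word_map ws 1 y)) (fst w) + word_deriv ws y h"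

lemma word_map_log_derivative: "has_log_derivative (word_map ws 1) (word_deriv ws y) y"
proof (induction ws)
  case Nil
  show ?case by (simp add: has_log_derivative_def)
next
  case (Cons w ws)
  have "has_log_derivative (\<lambda>y. lie_exp ((1 * (fst (snd w) + snd (snd w) \<bullet> y)) *\<^sub>R fst w))
      (\<lambda>h. (snd (snd w) \<bullet> h) *\<^sub>R fst w) y"
    by (rule has_log_derivative_compose[OF _ lie_exp_log_derivative]) (auto intro!: derivative_eq_intros)
  from has_log_derivative_mult[OF this Cons] show ?case
    by (simp add: linear_scale[OF linear_Ad])
qed

lemma continuous_on_word_map:
  assumes "continuous_on S f" "continuous_on S g"
  shows "continuous_on S (\<lambda>x. word_map ws (f x) (g x))"
proof (induction ws)
  case (Cons w ws)
  have "continuous_on S (\<lambda>x. lie_exp ((f x * (fst (snd w) + snd (snd w) \<bullet> g x)) *\<^sub>R fst w))"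
    by (intro continuous_on_lie_exp continuous_intros assms)
  from continuous_on_mult_group[OF this Cons] show ?case by simp
qed simp

lemma continuous_on_word_deriv: "continuous_on S (\<lambda>y. word_deriv ws y h)"
  by (induction ws) (auto intro!: continuous_intros continuous_on_word_map)

lemma word_map_0 [simp]: "word_map ws 0 y = \<one>"
  by (induction ws) auto

abbreviation base_word :: "('e \<times> real \<times> 'e) list \<Rightarrow> ('e \<times> real) list" where
  "base_word \<equiv> map (\<lambda>w. (fst w, fst (snd w)))"

lemma word_map_base: "word_map ws 1 0 = exp_prod (base_word ws)"
  by (induction ws) auto

text \<open>At \<open>y = 0\<close> the derivative of a word is the sum of its columns weighted by
  the functionals \<open>l \<bullet> h\<close>, which may be prescribed. Taking \<open>f\<close> to
  be the identity gives a parameter space of the same dimension as the group, as the inverse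
  function theorem requires.\<close>

lemma realize_word_deriv:
  assumes "linear f" "range f \<subseteq> span (exp_columns us)"
  obtains ws where "base_word ws = us" "word_deriv ws 0 = f"
proof -
  have "\<exists>ws. base_word ws = us \<and> word_deriv ws 0 = f"
    using assms
  proof (induction us arbitrary: f)
    case Nil
    then have "f h = 0" for h by auto
    then show ?case by (intro exI[of _ "[]"]) (auto simp: fun_eq_iff)
  next
    case (Cons u us)
    let ?u = "Ad (inv (exp_prod us)) (fst u)"
    interpret f: linear f by (rule Cons.prems)
    have "\<exists>k. f b - k *\<^sub>R ?u \<in> span (exp_columns us)" for b
      using Cons.prems(2) span_breakdown_eq[of "f b" ?u "exp_columns us"] by auto
    then obtain k where k: "\<And>b. f b - k b *\<^sub>R ?u \<in> span (exp_columns us)" by metis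
    \<comment> \<open>The vector representing the functional with value \<open>k b\<close> on each
      basis vector \<open>b\<close>; the remainder \<open>g\<close> then takes values in the span of
      the remaining columns.\<close>
    define l where "l = (\<Sum>b\<in>Basis. k b *\<^sub>R b)"
    define g where "g h = f h - (l \<bullet> h) *\<^sub>R ?u" for h
    have g: "linear g" unfolding g_def[abs_def]
      by (intro linear_compose_sub Cons.prems linearI) (auto simp: inner_add_right scaleR_add_left)
    have "g b \<in> span (exp_columns us)" if "b \<in> Basis" for b
      using k[of b] that by (simp add: g_def l_def)
    then have "g h \<in> span (exp_columns us)" for h
      using linear_sum[OF g, of "\<lambda>b. (h \<bullet> b) *\<^sub>R b" Basis] linear_scale[OF g]
      by (simp add: euclidean_representation) (auto intro!: span_sum span_scale)
    from Cons.IH[OF g] this obtain ws where ws: "base_word ws = us" "word_deriv ws 0 = g" by blast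
    have "word_deriv ((fst u, snd u, l) # ws) 0 = f"
      by (auto simp: ws word_map_base g_def fun_eq_iff)
    then show ?case using ws(1) by (intro exI[of _ "(fst u, snd u, l) # ws"]) simp
  qed
  then show ?thesis using that by blast
qed

text \<open>Dividing by the value at 0 brings the word map to the identity, where the fixed chart
  and the inverse function theorem apply. With \<open>B\<close> the parameters of positive times,
  this shows that the semigroup has interior; with \<open>B\<close> the whole space, it describes
  dilations near the identity.\<close>

lemma word_map_local_section:
  assumes "word_deriv ws 0 = (\<lambda>h. h)" "open B" "0 \<in> B"
  obtains N \<sigma> where "open N" "\<one> \<in> N" "continuous_on N \<sigma>" "\<sigma> ` N \<subseteq> B"
    "\<forall>x\<in>N. word_map ws 1 (\<sigma> x) = word_map ws 1 0 \<otimes> x"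
proof -
  let ?F = "word_map ws 1"
  define g where "g y = inv (?F 0) \<otimes> ?F y" for y
  have g0: "g 0 = \<one>" by (simp add: g_def)
  have g_log: "has_log_derivative g (word_deriv ws y) y" for y
    unfolding g_def[abs_def] by (intro has_log_derivative_left_mult word_map_log_derivative)
  have g_cont: "continuous_on UNIV g"
    unfolding g_def[abs_def] by (intro continuous_intros continuous_on_word_map)
  define Y where "Y = B \<inter> g -` U\<^sub>0"
  have Y: "open Y" "0 \<in> Y"
    using assms(2,3) g0 chart_at_one open_vimage[OF chart0(1) g_cont] by (auto simp: Y_def)
  define D where "D y h = d\<mu> (\<kappa>\<^sub>0 (g y), \<o>) (0, word_deriv ws y h)" for y h
  have der: "((\<lambda>y. \<kappa>\<^sub>0 (g y)) has_derivative D y) (at y)" if "y \<in> Y" for y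
    using has_log_derivative_in_chart[where f = g and x = y and L = "word_deriv ws y", OF chart_at_one(1) _ g_log] that
    by (simp add: Y_def left_inv_field_\<kappa>\<^sub>0 D_def[abs_def])
  have blf: "bounded_linear (D y)" if "y \<in> Y" for y using der[OF that] has_derivative_bounded_linear by blast
  have D_cont: "continuous_on Y (\<lambda>y. D y h)" for h
  proof -
    have "continuous_on Y (\<lambda>y. \<kappa>\<^sub>0 (g y))"
      by (rule continuous_on_compose2[OF chart0(3)]) (auto simp: Y_def intro: continuous_on_subset[OF g_cont])
    then show ?thesis unfolding D_def
      by (intro continuous_on_frechet_derivative[OF Ck_\<mu>] continuous_intros continuous_on_word_deriv)
        (auto simp: Y_def intro!: in_\<Omega>_origin)
  qed
  have D_app: "blinfun_apply (Blinfun (D y)) = D y" if "y \<in> Y" for y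
    using blf[OF that] by (rule bounded_linear_Blinfun_apply)
  have "continuous_on Y (\<lambda>y. Blinfun (D y))"
    by (rule continuous_on_blinfun_componentwise, rule continuous_on_eq[OF D_cont]) (simp add: D_app)
  \<comment> \<open>The derivative at 0 is the identity, because
    \<open>d\<mu> (\<o>, \<o>) (0, v) = v\<close>; so it is its own inverse.\<close>
  moreover have "id_blinfun o\<^sub>L Blinfun (D 0) = id_blinfun"
    by (rule blinfun_eqI) (simp add: D_app[OF Y(2)] D_def g0 d\<mu>_origin assms(1))
  moreover have "((\<lambda>y. \<kappa>\<^sub>0 (g y)) has_derivative blinfun_apply (Blinfun (D y))) (at y)" if "y \<in> Y" for y
    using der[OF that] by (simp add: D_app[OF that])
  ultimately obtain U' V \<tau> where V: "U' \<subseteq> Y" "open V" "\<kappa>\<^sub>0 (g 0) \<in> V"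
    "homeomorphism U' V (\<lambda>y. \<kappa>\<^sub>0 (g y)) \<tau>"
    using inverse_function_theorem[OF Y(1) _ _ Y(2), of "\<lambda>y. \<kappa>\<^sub>0 (g y)" "\<lambda>y. Blinfun (D y)" id_blinfun]
    by metis
  define N where "N = U\<^sub>0 \<inter> \<kappa>\<^sub>0 -` V"
  have "open N" unfolding N_def by (rule continuous_open_preimage[OF chart0(3) chart0(1) V(2)])
  moreover have "\<one> \<in> N" using V(3) chart_at_one by (simp add: N_def g0)
  moreover have "continuous_on N (\<lambda>x. \<tau> (\<kappa>\<^sub>0 x))"
  proof (rule continuous_on_compose2[of V \<tau>])
    show "continuous_on V \<tau>" using V(4) by (simp add: homeomorphism_def)
    show "continuous_on N \<kappa>\<^sub>0" by (rule continuous_on_subset[OF chart0(3)]) (simp add: N_def)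
  qed (auto simp: N_def)
  moreover have \<tau>_in: "\<tau> (\<kappa>\<^sub>0 x) \<in> U'" and \<tau>_eq: "\<kappa>\<^sub>0 (g (\<tau> (\<kappa>\<^sub>0 x))) = \<kappa>\<^sub>0 x" if "x \<in> N" for x
    using V(4) that unfolding homeomorphism_def N_def by auto
  then have "(\<lambda>x. \<tau> (\<kappa>\<^sub>0 x)) ` N \<subseteq> B" using V(1) by (auto simp: Y_def)
  moreover have "?F (\<tau> (\<kappa>\<^sub>0 x)) = ?F 0 \<otimes> x" if "x \<in> N" for x
  proof -
    have "g (\<tau> (\<kappa>\<^sub>0 x)) = x"
      using \<tau>_in[OF that] \<tau>_eq[OF that] V(1) that chart0(5) unfolding Y_def N_def
      by (metis IntD1 IntD2 subsetD vimageD)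
    then show ?thesis unfolding g_def by (metis inv_mult_cancel(2))
  qed
  ultimately show ?thesis using that[of N "\<lambda>x. \<tau> (\<kappa>\<^sub>0 x)"] by blast
qed

lemma word_map_in_semigroup:
  assumes "\<And>w. w \<in> set ws \<Longrightarrow> fst w \<in> W \<and> fst (snd w) + snd (snd w) \<bullet> y > 0"
  shows "word_map ws 1 y \<in> exp_semigroup W"
  using assms by (induction ws) (auto intro: exp_semigroup.intros)

end

section \<open>Dilations and the cone\<close>

context carnot_group
begin

lemma subspace_V1: "subspace (V 1)"
  using stratified unfolding stratification_def direct_sum_decomposition_def by auto

text \<open>Signs pass through the subspace and the bracket, so \<open>D\<close> contains
  \<open>V 1\<close> and is closed under brackets with it; the stratification then yields the layers
  one after another.\<close>

lemma first_layer_generates: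
  assumes "subspace D" "\<And>X. X \<in> V 1 \<Longrightarrow> X \<in> W \<or> - X \<in> W" "W \<subseteq> D"
    and bracket: "\<And>X Y. X \<in> W \<Longrightarrow> Y \<in> D \<Longrightarrow> lie_bracket X Y \<in> D"
  shows "D = UNIV"
proof -
  have V1: "V 1 \<subseteq> D"
    using assms(2,3) subspace_neg[OF assms(1)] by (metis minus_minus subset_iff)
  have br: "lie_bracket X Y \<in> D" if "X \<in> V 1" "Y \<in> D" for X Y
    using assms(2)[OF that(1)] bracket[OF _ that(2)] subspace_neg[OF assms(1)] lie_bracket_minus_left
    by (metis minus_minus)
  have V: "V j \<subseteq> D" if "j \<in> {1..s}" for j
  proof -
    have "1 \<le> j" using that by simp
    then have "j \<le> s \<longrightarrow> V j \<subseteq> D"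
    proof (induction j rule: dec_induct)
      case base
      show ?case using V1 by simp
    next
      case (step n)
      show ?case
      proof
        assume n: "Suc n \<le> s"
        then have "V (Suc n) = span {lie_bracket x y |x y. x \<in> V 1 \<and> y \<in> V n}"
          using stratified step unfolding stratification_def by auto
        moreover have "{lie_bracket x y |x y. x \<in> V 1 \<and> y \<in> V n} \<subseteq> D"
          using br step n by auto
        ultimately show "V (Suc n) \<subseteq> D" using span_minimal[OF _ assms(1)] by simp
      qed
    qed
    then show ?thesis using that by simp
  qed
  have "x \<in> D" for x
  proof -
    obtain v where v: "\<forall>j\<in>{1..s}. v j \<in> V j" "x = (\<Sum>j=1..s. v j)"
      using stratified unfolding stratification_def direct_sum_decomposition_def by metis
    have "v j \<in> D" if "j \<in> {1..s}" for j using v(1) V that by blast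
    then show ?thesis unfolding v(2) by (intro subspace_sum[OF assms(1)])
  qed
  then show ?thesis by blast
qed

section \<open>Dilations acting on exponentials and words\<close>

context
  fixes t :: real
  assumes t: "t > 0"
begin

lemma dilation_mult: "\<delta> t (x \<otimes> y) = \<delta> t x \<otimes> \<delta> t y"
  using dilation_automorphism[OF t] by (simp add: lie_automorphism_def iso_def hom_def)

lemma dilation_one: "\<delta> t \<one> = \<one>"
  using dilation_mult[of \<one> \<one>] by simp

lemma dilation_inv: "\<delta> t (inv x) = inv (\<delta> t x)"
  using dilation_mult[of "inv x" x] by (simp add: dilation_one inv_equality)

lemma continuous_on_dilation: "continuous_on S (\<delta> t)"
  using dilation_automorphism[OF t] continuous_on_subset
  by (auto simp: lie_automorphism_def smooth_map_def)

lemma open_dilation: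
  assumes "open S"
  shows "open (\<delta> t ` S)"
proof -
  have bij: "bij (\<delta> t)"
    using dilation_automorphism[OF t] by (simp add: lie_automorphism_def iso_def carrier_UNIV)
  have "\<delta> t ` S = inv_into UNIV (\<delta> t) -` S"
  proof (intro equalityI subsetI)
    fix y assume "y \<in> inv_into UNIV (\<delta> t) -` S"
    then show "y \<in> \<delta> t ` S"
      by (intro image_eqI[of _ _ "inv_into UNIV (\<delta> t) y"]) (simp_all add: surj_f_inv_f[OF bij_is_surj[OF bij]])
  qed (auto simp: inv_into_f_f[OF bij_is_inj[OF bij]])
  moreover have "continuous_on UNIV (inv_into UNIV (\<delta> t))"
    using dilation_automorphism[OF t] by (simp add: lie_automorphism_def smooth_map_def)
  ultimately show ?thesis using open_vimage[OF assms] by simp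
qed

text \<open>A homomorphism maps the increment \<open>inv (f x) \<otimes> f y\<close> to the
  increment of the image, which leaves its differential at the identity.\<close>

lemma dilation_log_derivative:
  fixes f :: "'a::real_normed_vector \<Rightarrow> 'g"
  assumes "has_log_derivative f L x"
  shows "has_log_derivative (\<lambda>y. \<delta> t (f y)) (\<lambda>h. differential_at_one (\<delta> t) (L h)) x"
proof -
  have f: "isCont f x" "((\<lambda>y. \<kappa>\<^sub>0 (inv (f x) \<otimes> f y)) has_derivative L) (at x)"
    using assms by (auto simp: has_log_derivative_def)
  have "(\<lambda>z. \<kappa>\<^sub>0 (\<delta> t (\<phi> z))) differentiable (at \<o>)"
    using dilation_automorphism[OF t] chart_at_one
    by (intro smooth_map_differentiable) (auto simp: lie_automorphism_def dilation_one)
  then have "((\<lambda>z. \<kappa>\<^sub>0 (\<delta> t (\<phi> z))) has_derivative differential_at_one (\<delta> t)) (at \<o>)"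
    unfolding differential_at_one_def by (simp add: frechet_derivative_works)
  then have "((\<lambda>y. \<kappa>\<^sub>0 (\<delta> t (\<phi> (\<kappa>\<^sub>0 (inv (f x) \<otimes> f y))))) has_derivative (\<lambda>h. differential_at_one (\<delta> t) (L h))) (at x)"
    by (intro has_derivative_compose[OF f(2)]) simp
  then have "((\<lambda>y. \<kappa>\<^sub>0 (inv (\<delta> t (f x)) \<otimes> \<delta> t (f y))) has_derivative (\<lambda>h. differential_at_one (\<delta> t) (L h))) (at x)"
  proof (rule has_derivative_transform_eventually)
    show "\<forall>\<^sub>F y in at x. \<kappa>\<^sub>0 (\<delta> t (\<phi> (\<kappa>\<^sub>0 (inv (f x) \<otimes> f y)))) = \<kappa>\<^sub>0 (inv (\<delta> t (f x)) \<otimes> \<delta> t (f y))"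
      using log_derivative_in_U\<^sub>0[OF f(1)] by eventually_elim (simp add: chart0 dilation_mult dilation_inv)
  qed (simp_all add: dilation_one)
  moreover have "isCont (\<lambda>y. \<delta> t (f y)) x"
    using continuous_on_dilation[of UNIV] by (intro isCont_o2[OF f(1)]) (simp add: continuous_on_eq_continuous_at)
  ultimately show ?thesis by (simp add: has_log_derivative_def)
qed

text \<open>The image of the integral curve of \<open>X\<close> is an integral curve of
  \<open>t *\<^sub>R X\<close>, and integral curves are unique.\<close>

lemma dilation_lie_exp:
  assumes "X \<in> V 1"
  shows "\<delta> t (lie_exp X) = lie_exp (t *\<^sub>R X)"
proof -
  have "differential_at_one (\<delta> t) (h *\<^sub>R X) = h *\<^sub>R (t *\<^sub>R X)" for h
    using dilation_differential[OF t subspace_scale[OF subspace_V1 assms]] by (simp add: mult.commute)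
  then have "has_log_derivative (\<lambda>u. \<delta> t (lie_exp (u *\<^sub>R X))) (\<lambda>h. h *\<^sub>R (t *\<^sub>R X)) u" for u
    using dilation_log_derivative[OF lie_exp_log_derivative[of X u]] by simp
  then have "integral_curve_from_one (t *\<^sub>R X) (\<lambda>u. \<delta> t (lie_exp (u *\<^sub>R X)))"
    by (simp only: integral_curve_iff) (simp add: dilation_one)
  from lie_exp_eq[OF this] show ?thesis by simp
qed

lemma dilation_lie_exp_scaleR:
  assumes "X \<in> V 1"
  shows "\<delta> t (lie_exp (c *\<^sub>R X)) = lie_exp ((t * c) *\<^sub>R X)"
  using dilation_lie_exp[OF subspace_scale[OF subspace_V1 assms]] by simp

lemma dilation_word_map:
  assumes "\<And>w. w \<in> set ws \<Longrightarrow> fst w \<in> V 1"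
  shows "\<delta> t (word_map ws 1 y) = word_map ws t y"
  using assms
  by (induction ws) (simp_all add: dilation_one dilation_mult dilation_lie_exp_scaleR del: One_nat_def)

lemma dilation_exp_semigroup:
  assumes "q \<in> exp_semigroup W" "W \<subseteq> V 1"
  shows "\<delta> t q \<in> exp_semigroup W"
  using assms(1)
proof induction
  case one
  show ?case by (simp add: dilation_one exp_semigroup.one)
next
  case (step X c q)
  then have "X \<in> V 1" using assms(2) by blast
  then have "\<delta> t (lie_exp (c *\<^sub>R X)) = lie_exp ((t * c) *\<^sub>R X)"
    by (rule dilation_lie_exp_scaleR)
  then show ?case using step t by (auto simp: dilation_mult intro!: exp_semigroup.step)
qed

end

text \<open>The rules for composing dilations are recovered on products of exponentials of
  \<open>V 1\<close>, where a dilation multiplies the times; this and the next lemma are the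
  instances required for the cone.\<close>

lemma dilation_inverse_on_semigroup:
  assumes "q \<in> exp_semigroup W" "W \<subseteq> V 1" "t > 0"
  shows "\<delta> t (\<delta> (1 / t) q) = q"
  using assms(1)
proof induction
  case one
  show ?case using assms(3) by (simp add: dilation_one)
next
  case (step X c q)
  then have "X \<in> V 1" using assms(2) by blast
  then show ?case using step assms(3)
    by (simp add: dilation_mult dilation_lie_exp_scaleR del: One_nat_def)
qed

lemma dilation_1_on_semigroup:
  assumes "q \<in> exp_semigroup W" "W \<subseteq> V 1"
  shows "\<delta> 1 q = q"
  using assms(1)
proof induction
  case one
  show ?case by (simp add: dilation_one)
next
  case (step X c q)
  then have "X \<in> V 1" using assms(2) by blast
  then show ?case using step
    by (simp add: dilation_mult dilation_lie_exp_scaleR del: One_nat_def)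
qed

text \<open>The value \<open>\<one>\<close> is the limit of the dilations at \<open>t = 0\<close>.
  Used for negative \<open>t\<close> too, it makes each \<open>dilation0 t\<close> a homomorphism
  without a condition on \<open>t\<close>.\<close>

definition dilation0 :: "real \<Rightarrow> 'g \<Rightarrow> 'g" where
  "dilation0 t x = (if t > 0 then \<delta> t x else \<one>)"

lemma dilation0_mult: "dilation0 t (x \<otimes> y) = dilation0 t x \<otimes> dilation0 t y"
  by (simp add: dilation0_def dilation_mult)

lemma dilation0_inv: "dilation0 t (inv x) = inv (dilation0 t x)"
  by (simp add: dilation0_def dilation_inv)

lemma open_left_translate:
  assumes "open N"
  shows "open {x. a \<otimes> x \<in> N}"
proof -
  have "continuous_on UNIV (\<lambda>x. a \<otimes> x)" by (intro continuous_intros)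
  from open_vimage[OF assms this] show ?thesis by (simp add: vimage_def)
qed

text \<open>Simple connectedness makes the constant loops at \<open>x\<close> and \<open>y\<close>
  homotopic, and the base point of the loop traces a path between them.\<close>

lemma connected_group: "connected (UNIV :: 'g set)"
proof -
  have "path_component UNIV x y" for x y :: 'g
  proof -
    have "homotopic_loops UNIV (\<lambda>_. x) (\<lambda>_. y)"
      using simply_connected_group unfolding simply_connected_def
      by (auto simp: path_def pathfinish_def pathstart_def)
    then obtain h where h: "continuous_on ({0..1} \<times> {0..1}) h"
      "\<And>u. u \<in> {0..1} \<Longrightarrow> h (0::real, u::real) = x" "\<And>u. u \<in> {0..1} \<Longrightarrow> h (1, u) = y"
      unfolding homotopic_loops by auto
    have "continuous_on {0..1} (\<lambda>t. h (t, 0))"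
      by (rule continuous_on_compose2[OF h(1)]) (auto intro!: continuous_intros)
    then show ?thesis
      using h(2,3)[of 0] unfolding path_component_def
      by (intro exI[of _ "\<lambda>t. h (t, 0)"]) (auto simp: path_def pathfinish_def pathstart_def)
  qed
  then have "path_connected (UNIV :: 'g set)" by (simp add: path_connected_component)
  then show ?thesis by (rule path_connected_imp_connected)
qed

text \<open>\<open>Q\<close> and its complement are both unions of left translates of
  \<open>N\<close>, hence open, and the group is connected.\<close>

lemma open_subgroup_UNIV:
  assumes "open N" "\<one> \<in> N" "N \<subseteq> Q"
    and mult: "\<And>x y. x \<in> Q \<Longrightarrow> y \<in> Q \<Longrightarrow> x \<otimes> y \<in> Q"
    and inv: "\<And>x. x \<in> Q \<Longrightarrow> inv x \<in> Q"
  shows "Q = UNIV"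
proof -
  have nbhd: "open {y. inv x \<otimes> y \<in> N}" "x \<in> {y. inv x \<otimes> y \<in> N}" for x
    using open_left_translate[OF assms(1)] assms(2) by auto
  have sub: "{y. inv x \<otimes> y \<in> N} \<subseteq> Q" if "x \<in> Q" for x
  proof clarify
    fix y assume "inv x \<otimes> y \<in> N"
    then have "x \<otimes> (inv x \<otimes> y) \<in> Q" using mult[OF that] assms(3) by blast
    then show "y \<in> Q" by simp
  qed
  have sub': "{y. inv x \<otimes> y \<in> N} \<subseteq> - Q" if x: "x \<in> - Q" for x
  proof clarify
    fix y assume y: "inv x \<otimes> y \<in> N" "y \<in> Q"
    have "y \<otimes> inv (inv x \<otimes> y) = x"
      by (simp add: inv_mult_group)
    moreover have "y \<otimes> inv (inv x \<otimes> y) \<in> Q" using y mult inv assms(3) by blast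
    ultimately show False using x by simp
  qed
  have "open Q" unfolding open_subopen[of Q] using nbhd sub by blast
  moreover have "open (- Q)" unfolding open_subopen[of "- Q"] using nbhd sub' by blast
  ultimately have "Q = {} \<or> Q = UNIV"
    using connected_group unfolding connected_clopen by (simp add: closed_def)
  then show ?thesis using assms(2,3) by blast
qed

text \<open>Near the identity the dilations act on the times in a word, and so they extend continuously
  to \<open>t = 0\<close>; the elements where this extension is continuous form an open subgroup.\<close>

lemma continuous_on_dilation0:
  assumes ws: "word_deriv ws 0 = (\<lambda>h. h)" "\<And>w. w \<in> set ws \<Longrightarrow> fst w \<in> V 1"
  shows "continuous_on ({0..} \<times> UNIV) (\<lambda>p. dilation0 (fst p) (snd p))"
proof -
  obtain N \<sigma> where N: "open N" "\<one> \<in> N" "continuous_on N \<sigma>" "\<sigma> ` N \<subseteq> UNIV"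
    "\<forall>x\<in>N. word_map ws 1 (\<sigma> x) = word_map ws 1 0 \<otimes> x"
    by (rule word_map_local_section[OF ws(1) open_UNIV UNIV_I])
  \<comment> \<open>Here \<open>x\<close> is the quotient of two words at \<open>t = 1\<close>, and
    \<open>\<delta> t\<close> multiplies the times of both. At \<open>t = 0\<close> both words
    become \<open>\<one>\<close>, in agreement with \<open>dilation0\<close>.\<close>
  have "dilation0 t x = inv (word_map ws t 0) \<otimes> word_map ws t (\<sigma> x)" if "x \<in> N" "t \<ge> 0" for t x
  proof (cases "t > 0")
    case True
    have "x = inv (word_map ws 1 0) \<otimes> word_map ws 1 (\<sigma> x)" using N(5)[THEN bspec, OF that(1)] by simp
    then have "\<delta> t x = inv (\<delta> t (word_map ws 1 0)) \<otimes> \<delta> t (word_map ws 1 (\<sigma> x))"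
      using dilation_mult[OF True] dilation_inv[OF True] by metis
    then show ?thesis using True dilation_word_map[OF True ws(2)] by (simp add: dilation0_def)
  qed (use that in \<open>simp add: dilation0_def\<close>)
  moreover have "continuous_on ({0..} \<times> N) (\<lambda>p. inv (word_map ws (fst p) 0) \<otimes> word_map ws (fst p) (\<sigma> (snd p)))"
    by (intro continuous_intros continuous_on_word_map continuous_on_compose2[OF N(3)]) auto
  ultimately have local: "continuous_on ({0..} \<times> N) (\<lambda>p. dilation0 (fst p) (snd p))"
    using continuous_on_eq by (auto elim!: continuous_on_eq)
  \<comment> \<open>Continuity in \<open>t\<close> alone comes first: \<open>Q\<close> is a
    subgroup, since each \<open>dilation0 t\<close> is a homomorphism.\<close>
  define Q where "Q = {x. continuous_on {0..} (\<lambda>t. dilation0 t x)}"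
  have "Q = UNIV"
  proof (rule open_subgroup_UNIV[OF N(1,2)])
    show "N \<subseteq> Q"
    proof
      fix x assume "x \<in> N"
      then have "continuous_on {0..} (\<lambda>t. dilation0 (fst (t, x)) (snd (t, x)))"
        by (intro continuous_on_compose2[OF local]) (auto intro!: continuous_intros)
      then show "x \<in> Q" by (simp add: Q_def)
    qed
  qed (auto simp: Q_def dilation0_mult dilation0_inv intro!: continuous_intros)
  then have Q: "continuous_on {0..} (\<lambda>t. dilation0 t x)" for x by (auto simp: Q_def)
  show ?thesis
    unfolding continuous_on_eq_continuous_within
  proof
    fix p :: "real \<times> 'g" assume "p \<in> {0..} \<times> UNIV"
    then obtain t x where p: "p = (t, x)" "t \<ge> 0" by auto
    \<comment> \<open>For joint continuity at \<open>(t, x)\<close>, a nearby \<open>y\<close> is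
      split as \<open>x \<otimes> (inv x \<otimes> y)\<close>: the first factor is fixed and uses
      \<open>Q\<close>, the second lies in \<open>N\<close> and uses \<open>local\<close>.\<close>
    let ?M = "{y. inv x \<otimes> y \<in> N}"
    have "continuous_on ({0..} \<times> ?M) (\<lambda>p. dilation0 (fst p) x \<otimes> dilation0 (fst (fst p, inv x \<otimes> snd p)) (snd (fst p, inv x \<otimes> snd p)))"
      by (intro continuous_on_mult_group continuous_on_compose2[OF Q] continuous_on_compose2[OF local])
        (auto intro!: continuous_intros)
    then have "continuous_on ({0..} \<times> ?M) (\<lambda>p. dilation0 (fst p) (snd p))"
      by (simp flip: dilation0_mult)
    then have "continuous (at p within {0..} \<times> ?M) (\<lambda>p. dilation0 (fst p) (snd p))"
      using p N(2) unfolding continuous_on_eq_continuous_within by auto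
    moreover have "at p within {0..} \<times> ?M = at p within {0..} \<times> UNIV"
      by (rule at_within_nhd[of _ "UNIV \<times> ?M"])
        (use p N(2) open_left_translate[OF N(1)] in \<open>auto intro!: open_Times\<close>)
    ultimately show "continuous (at p within {0..} \<times> UNIV) (\<lambda>p. dilation0 (fst p) (snd p))" by simp
  qed
qed

text \<open>The identity may lie outside \<open>C\<close>, so shrinking by dilations alone could end
  outside \<open>C\<close>; the growing factor \<open>\<delta> t p\<close> keeps the homotopy
  inside.\<close>

lemma contractible_dilation_invariant_semigroup:
  assumes "continuous_on ({0..} \<times> UNIV) (\<lambda>p. dilation0 (fst p) (snd p))"
    and "p \<in> C" "\<And>t x. t > 0 \<Longrightarrow> x \<in> C \<Longrightarrow> \<delta> t x \<in> C"
    and "\<And>x. x \<in> C \<Longrightarrow> \<delta> 1 x = x"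
    and "\<And>x y. x \<in> C \<Longrightarrow> y \<in> C \<Longrightarrow> x \<otimes> y \<in> C"
  shows "contractible C"
proof -
  define h where "h q = dilation0 (1 - fst q) (snd q) \<otimes> dilation0 (fst q) p" for q
  have "continuous_on ({0..1} \<times> C) (\<lambda>q. dilation0 (fst (1 - fst q, snd q)) (snd (1 - fst q, snd q)) \<otimes> dilation0 (fst (fst q, p)) (snd (fst q, p)))"
    by (intro continuous_on_mult_group continuous_on_compose2[OF assms(1)]) (auto intro!: continuous_intros)
  then have "continuous_on ({0..1} \<times> C) h" by (simp add: h_def[abs_def])
  moreover have "h (t, x) \<in> C" if t: "t \<in> {0..1}" and x: "x \<in> C" for t x
  proof -
    \<comment> \<open>At the endpoints one factor is \<open>\<one>\<close>, which need not belong to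
      \<open>C\<close>, so closure under products helps only in between.\<close>
    consider "t = 0" | "t = 1" | "0 < t" "t < 1" using t by fastforce
    then show ?thesis
      using x assms(2,3,5) by cases (auto simp: h_def dilation0_def)
  qed
  ultimately have "continuous_map (prod_topology (top_of_set {0..1}) (top_of_set C)) (top_of_set C) h"
    by (auto simp: continuous_map_in_subtopology subtopology_Times[symmetric])
  moreover have "h (0, x) = x" "h (1, x) = p" if "x \<in> C" for x
    using assms(2,4) that by (simp_all add: h_def dilation0_def)
  ultimately have "homotopic_with_canon (\<lambda>_. True) C C id (\<lambda>_. p)"
    by (subst homotopic_with) (auto intro!: exI[of _ h])
  then show ?thesis unfolding contractible_def by blast
qed

lemma open_cone_property:
  assumes W: "W \<subseteq> V 1" "\<And>X. X \<in> V 1 \<Longrightarrow> X \<in> W \<or> - X \<in> W"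
    and E: "\<And>X t. X \<in> W \<Longrightarrow> t > 0 \<Longrightarrow> E #> lie_exp (t *\<^sub>R X) \<subseteq> E"
  shows "\<exists>C. open C \<and> contractible C \<and> cone C \<and> E <#> C \<subseteq> E"
proof -
  obtain us where us: "us \<in> positive_words W" "span (exp_columns us) = UNIV"
    using spanning_word[of W] first_layer_generates[OF _ W(2)] by blast
  obtain ws where ws: "base_word ws = us" "word_deriv ws 0 = (\<lambda>h. h)"
    using realize_word_deriv[of "\<lambda>h. h" us] us(2) linear_id by (auto simp: id_def)
  have ws_pos: "fst w \<in> W \<and> fst (snd w) > 0" if "w \<in> set ws" for w
  proof -
    have "(fst w, fst (snd w)) \<in> set us" using that ws(1) by force
    then show ?thesis using us(1) by auto
  qed
  have ws_V1: "\<And>w. w \<in> set ws \<Longrightarrow> fst w \<in> V 1" using ws_pos W(1) by blast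
  note cont = continuous_on_dilation0[OF ws(2) ws_V1]
  let ?S = "exp_semigroup W"
  define C where "C = interior ?S"
  have C_S: "C \<subseteq> ?S" by (simp add: C_def interior_subset)
  \<comment> \<open>The parameters for which all times of the word remain positive; openness uses
    that the word has finitely many factors.\<close>
  define B where "B = (\<Inter>w\<in>set ws. {y. fst (snd w) + snd (snd w) \<bullet> y > 0})"
  have B: "open B" unfolding B_def
    by (intro open_INT finite_set ballI open_Collect_less continuous_intros)
  have B0: "0 \<in> B" using ws_pos by (auto simp: B_def)
  obtain N \<sigma> where N: "open N" "\<one> \<in> N" "continuous_on N \<sigma>" "\<sigma> ` N \<subseteq> B"
    "\<forall>x\<in>N. word_map ws 1 (\<sigma> x) = word_map ws 1 0 \<otimes> x"
    by (rule word_map_local_section[OF ws(2) B B0])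
  let ?p = "word_map ws 1 0"
  have p: "?p \<in> C"
  proof -
    \<comment> \<open>The translate of \<open>N\<close> by \<open>?p\<close> consists of values of
      the word at parameters in \<open>B\<close>, so \<open>?p\<close> is an interior point of the
      semigroup.\<close>
    have "{x. inv ?p \<otimes> x \<in> N} \<subseteq> ?S"
    proof
      fix x assume "x \<in> {x. inv ?p \<otimes> x \<in> N}"
      then have x: "inv ?p \<otimes> x \<in> N" by simp
      have "word_map ws 1 (\<sigma> (inv ?p \<otimes> x)) \<in> ?S"
        by (rule word_map_in_semigroup) (use x N(4) ws_pos in \<open>auto simp: B_def image_subset_iff\<close>)
      then show "x \<in> ?S" using N(5)[THEN bspec, OF x] by simp
    qed
    then show ?thesis unfolding C_def
      using interiorI[OF open_left_translate[OF N(1), of "inv ?p"]] N(2) by simp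
  qed
  have dil_sub: "\<delta> t ` C \<subseteq> C" if "t > 0" for t
  proof -
    have "\<delta> t ` C \<subseteq> ?S" using dilation_exp_semigroup[OF that _ W(1)] C_S by blast
    moreover have "open (\<delta> t ` C)" by (rule open_dilation[OF that]) (simp add: C_def)
    ultimately show ?thesis unfolding C_def by (rule interior_maximal)
  qed
  have dil_eq: "\<delta> t ` C = C" if "t > 0" for t
  proof
    show "C \<subseteq> \<delta> t ` C"
    proof
      fix x assume x: "x \<in> C"
      then have "x = \<delta> t (\<delta> (1 / t) x)" using dilation_inverse_on_semigroup[OF _ W(1) that] C_S by fastforce
      moreover have "\<delta> (1 / t) x \<in> C" using dil_sub[of "1 / t"] that x by auto
      ultimately show "x \<in> \<delta> t ` C" by blast
    qed
  qed (rule dil_sub[OF that])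
  have mult: "x \<otimes> y \<in> C" if "x \<in> C" "y \<in> C" for x y
  proof -
    \<comment> \<open>The set is the left translate of \<open>C\<close> by \<open>x\<close>: it is
      open, lies in the semigroup and contains \<open>x \<otimes> y\<close>.\<close>
    have sub: "{z. inv x \<otimes> z \<in> C} \<subseteq> ?S"
    proof
      fix z assume "z \<in> {z. inv x \<otimes> z \<in> C}"
      then have "x \<otimes> (inv x \<otimes> z) \<in> ?S" using that(1) C_S by (blast intro: exp_semigroup_mult)
      then show "z \<in> ?S" by simp
    qed
    have "open {z. inv x \<otimes> z \<in> C}" by (rule open_left_translate) (simp add: C_def)
    then have "x \<otimes> y \<in> interior ?S" by (rule interiorI[OF _ _ sub]) (simp add: that)
    then show ?thesis by (simp only: C_def)
  qed
  have E_S: "x \<otimes> q \<in> E" if "q \<in> ?S" "x \<in> E" for x q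
    using that
  proof (induction arbitrary: x)
    case (step X t q)
    have "x \<otimes> lie_exp (t *\<^sub>R X) \<in> E"
    proof (rule subsetD[OF E[OF step.hyps(1,2)]])
      show "x \<otimes> lie_exp (t *\<^sub>R X) \<in> E #> lie_exp (t *\<^sub>R X)"
        using step.prems by (auto simp: r_coset_def)
    qed
    from step.IH[OF this] show ?case by (simp add: m_assoc)
  qed simp
  have "E <#> C \<subseteq> E" using E_S C_S by (auto simp: set_mult_def)
  moreover have "contractible C"
  proof (rule contractible_dilation_invariant_semigroup[OF cont p _ _ mult])
    show "\<delta> t x \<in> C" if "t > 0" "x \<in> C" for t x using dil_sub that by blast
    show "\<delta> 1 x = x" if "x \<in> C" for x using dilation_1_on_semigroup[OF _ W(1)] C_S that by blast
  qed
  moreover have "cone C" using dil_eq p by (auto simp: cone_def)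
  ultimately show ?thesis using C_def by blast
qed

end

theorem theorem1p6:
  fixes G :: "('g::{t2_space, second_countable_topology}, 'm) monoid_scheme"
    and A :: "('g, 'e::euclidean_space) chart set"
    and U\<^sub>0 :: "'g set" and \<kappa>\<^sub>0 :: "'g \<Rightarrow> 'e"
    and V :: "nat \<Rightarrow> 'e set" and s :: nat and \<delta> :: "real \<Rightarrow> 'g \<Rightarrow> 'g"
    and E :: "'g set"
  assumes "carnot_group G A U\<^sub>0 \<kappa>\<^sub>0 V s \<delta>"
    and "carnot_group.precisely_constant_normal G A U\<^sub>0 \<kappa>\<^sub>0 V E"
  shows "\<exists>C. open C \<and> contractible C \<and> carnot_group.cone \<delta> C \<and> E <#>\<^bsub>G\<^esub> C \<subseteq> E"
proof -
  interpret carnot_group G A U\<^sub>0 \<kappa>\<^sub>0 V s \<delta> by (rule assms(1))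
  obtain W where W: "closed_half_space (V 1) W" "\<And>X. X \<in> W \<Longrightarrow> precisely_monotone X E"
    using assms(2) unfolding precisely_constant_normal_def by blast
  then obtain ip X where ip: "scalar_product_on (V 1) ip" "X \<in> V 1" "W = {Y \<in> V 1. ip Y X \<ge> 0}"
    unfolding closed_half_space_def by blast
  show ?thesis
  proof (rule open_cone_property)
    show "W \<subseteq> V 1" using ip(3) by blast
    show "Y \<in> W \<or> - Y \<in> W" if "Y \<in> V 1" for Y
    proof -
      \<comment> \<open>\<open>ip\<close> changes sign with its first argument, so at least one of
        \<open>Y\<close> and \<open>- Y\<close> lies in the half-space.\<close>
      have "ip (- Y) X = - ip Y X"
        using ip(1,2) that unfolding scalar_product_on_def by (metis mult_minus1 scaleR_minus1_left)
      moreover have "- Y \<in> V 1" using subspace_neg[OF subspace_V1 that] .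
      ultimately show ?thesis using that by (auto simp: ip(3))
    qed
    show "E #>\<^bsub>G\<^esub> lie_exp (t *\<^sub>R Y) \<subseteq> E" if "Y \<in> W" "t > 0" for Y t
      using W(2)[OF that(1)] that(2) by (simp add: precisely_monotone_def)
  qed
qed

end
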